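(* Let $k$ be an algebraically closed field with $\operatorname{char}(k)\neq 2,3$ and let $V$ be a 3-dimensional $k$-vector space. Fix a basis $\{x,y,z\}$ for $V$ and let $w_0=\frac13(xyz+yzx+zxy-zyx-xzy-yxz)\in V^{\otimes 3}$. Let $f\in S^3V$, $\lambda\in k$, and $w\in V^{\otimes 3}$. (1) $A_{f,\lambda}=J(w_0-\lambda\widehat{f}\,)$. (2) If $c(w)\neq s(w)$, then $J(w)=A_{\overline{w},\nu}$ where $\nu=-\mu(w)^{-1}$. (3) If $c(w)=s(w)$, then $J(w)$ is not isomorphic, as a graded $k$-algebra, to any $A_{\pi,\lambda}$.
   Context: $TV$, $SV$ are the tensor and symmetric algebras, graded with $\deg V=1$; $w\mapsto\overline{w}$ is the canonical map $TV\to SV$; $f\mapsto\widehat{f}$ denotes the inverse of its restriction $\operatorname{Sym}^m(V)\to S^mV$, where $\operatorname{Sym}^m(V)\subseteq V^{\otimes m}$ is the space of symmetric tensors. For a word $w$ in $x,y,z$, $\partial_x(w):=\sum_{w=uxv}vu$ (sum over all such factorizations), extended linearly to $TV$; $\partial_y,\partial_z$ are similar. $J(w):=TV/(\partial_x(w),\partial_y(w),\partial_z(w))$. $S_3$ acts on $V^{\otimes 3}$ by permuting tensor factors; $c=\frac13(1+(123)+(321))$, $s=\frac16\sum_{g\in S_3}g$; $\mu:V^{\otimes 3}\to k$ is the linear map with $c(w)-s(w)=\mu(w)w_0$. A quadratic Poisson bracket on $SV$ is a Poisson bracket $\{\cdot,\cdot\}_\pi$ on the commutative algebra $SV$ ($\pi$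 being the corresponding bivector field) with $\{V,V\}_\pi\subseteq S^2V$. For such $\pi$ and $\lambda\in k$, $R_{\pi,\lambda}=\{u\otimes v-v\otimes u-\lambda\widehat{\{u,v\}_\pi}\mid u,v\in V\}$ and $A_{\pi,\lambda}=TV/(R_{\pi,\lambda})$. For $f\in S^3V$, $\{\cdot,\cdot\}_f$ is the quadratic Poisson bracket with $\{x,y\}_f=\partial f/\partial z$, $\{y,z\}_f=\partial f/\partial x$, $\{z,x\}_f=\partial f/\partial y$, and $A_{f,\lambda}$ is the corresponding algebra: $k\langle x,y,z\rangle$ modulo $xy-yx=\lambda\widehat{f_z}$, $yz-zy=\lambda\widehat{f_x}$, $zx-xz=\lambda\widehat{f_y}$. Equality of algebras in (1), (2) means equality as quotients of $TV$. *)

theory Defs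
  imports
    "HOL-Algebra.QuotRing"
    "HOL-Algebra.Module"
    "HOL-Algebra.Algebraic_Closure_Type"
    "HOL-Combinatorics.Permutations"
    "HOL-Combinatorics.Cycles"
    "HOL-Library.Poly_Mapping"
begin

text \<open>
  The vector space \<open>V\<close> with its fixed basis is modelled as the space with basis
  \<open>letter\<close>. Then \<open>TV\<close> is the space of finitely supported functions on words,
  that is the free algebra \<open>k\<langle>x,y,z\<rangle>\<close>, and \<open>SV\<close> is the space of
  finitely supported functions on exponent vectors, that is \<open>k[x,y,z]\<close>. In both cases
  \<open>V\<close> itself is the component of degree 1.
\<close>

datatype letter = Lx | Ly | Lz

lemma UNIV_letter: "UNIV = {Lx, Ly, Lz}"
  using letter.exhaust by auto

text \<open>
  The product of \<^typ>\<open>'a \<Rightarrow>\<^sub>0 'b\<close> is the convolution product with respect to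
  \<^term>\<open>(+)\<close> on \<^typ>\<open>'a\<close>, so the monoid of words has to be written additively:
  on lists, \<open>+\<close> is concatenation and \<open>0\<close> is the empty word.
\<close>

instantiation list :: (type) monoid_add
begin
definition zero_list_def: "0 = []"
definition plus_list_def: "xs + ys = xs @ ys"
instance by standard (simp_all add: zero_list_def plus_list_def)
end

type_synonym 'k tensor = "letter list \<Rightarrow>\<^sub>0 'k"
type_synonym 'k spoly = "(letter \<Rightarrow>\<^sub>0 nat) \<Rightarrow>\<^sub>0 'k"

definition scale :: "'k::comm_ring_1 \<Rightarrow> ('b \<Rightarrow>\<^sub>0 'k) \<Rightarrow> ('b \<Rightarrow>\<^sub>0 'k)" (infixr \<open>*\<^sub>k\<close> 75)
  where "a *\<^sub>k p = Poly_Mapping.map ((*) a) p"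

definition lin_ext :: "('b \<Rightarrow> ('c \<Rightarrow>\<^sub>0 'k)) \<Rightarrow> ('b \<Rightarrow>\<^sub>0 'k::comm_ring_1) \<Rightarrow> ('c \<Rightarrow>\<^sub>0 'k)"
  where "lin_ext g p = (\<Sum>b\<in>Poly_Mapping.keys p. Poly_Mapping.lookup p b *\<^sub>k g b)"

definition word :: "letter list \<Rightarrow> 'k::field tensor"
  where "word w = Poly_Mapping.single w 1"

definition svar :: "letter \<Rightarrow> 'k::field spoly"
  where "svar a = Poly_Mapping.single (Poly_Mapping.single a 1) 1"

text \<open>
  \<open>tens n\<close> is \<open>V\<close> to the tensor power \<open>n\<close>, and \<open>spow n\<close> is \<open>S\<^sup>nV\<close>.
\<close>

definition tens :: "nat \<Rightarrow> 'k::field tensor set"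
  where "tens n = {t. \<forall>w\<in>Poly_Mapping.keys t. length w = n}"

definition spow :: "nat \<Rightarrow> 'k::field spoly set"
  where "spow n = {p. \<forall>m\<in>Poly_Mapping.keys p.
                       (\<Sum>a\<in>Poly_Mapping.keys m. Poly_Mapping.lookup m a) = n}"

definition bar :: "'k::field tensor \<Rightarrow> 'k spoly"
  where "bar = lin_ext (\<lambda>w. prod_list (map svar w))"

text \<open>
  The factor in position \<open>i\<close> is moved to position \<open>\<sigma> i\<close>. Positions are counted
  from 0, so \<open>S\<^sub>n\<close> consists of the \<open>\<sigma>\<close> with \<open>\<sigma> permutes {..<n}\<close>.
\<close>

definition perm_act :: "(nat \<Rightarrow> nat) \<Rightarrow> 'k::field tensor \<Rightarrow> 'k tensor"
  where "perm_act \<sigma> = lin_ext (\<lambda>w. word (permute_list (inv_into UNIV \<sigma>) w))"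

definition sym_tens :: "nat \<Rightarrow> 'k::field tensor set"
  where "sym_tens n = {t \<in> tens n. \<forall>\<sigma>. \<sigma> permutes {..<n} \<longrightarrow> perm_act \<sigma> t = t}"

text \<open>
  If \<open>n!\<close> is invertible in \<open>k\<close>, then \<open>bar\<close> maps \<open>sym_tens n\<close> bijectively onto
  \<open>spow n\<close>; only \<open>n = 2\<close> and \<open>n = 3\<close> are used.
\<close>

definition hat :: "nat \<Rightarrow> 'k::field spoly \<Rightarrow> 'k tensor"
  where "hat n = the_inv_into (sym_tens n) bar"

definition cyc_sym :: "'k::field tensor \<Rightarrow> 'k tensor"
  where "cyc_sym t = (1/3) *\<^sub>k
    (t + perm_act (cycle_of_list [0, 1, 2]) t + perm_act (cycle_of_list [2, 1, 0]) t)"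

definition full_sym :: "'k::field tensor \<Rightarrow> 'k tensor"
  where "full_sym t = (1/6) *\<^sub>k (\<Sum>\<sigma> | \<sigma> permutes {..<3}. perm_act \<sigma> t)"

definition w0 :: "'k::field tensor"
  where "w0 = (1/3) *\<^sub>k (word [Lx,Ly,Lz] + word [Ly,Lz,Lx] + word [Lz,Lx,Ly]
                       - word [Lz,Ly,Lx] - word [Lx,Lz,Ly] - word [Ly,Lx,Lz])"

definition mu :: "'k::field tensor \<Rightarrow> 'k"
  where "mu t = (THE a. cyc_sym t - full_sym t = a *\<^sub>k w0)"

definition cyc_deriv :: "letter \<Rightarrow> 'k::field tensor \<Rightarrow> 'k tensor"
  where "cyc_deriv a =
    lin_ext (\<lambda>w. \<Sum>(u, v) | w = u @ [a] @ v. word (v @ u))"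

record ('a, 'b) graded_algebra = "('a, 'b) module" +
  component :: "nat \<Rightarrow> 'b set"

definition graded_algebra_iso ::
  "('k, 'a, 'm) graded_algebra_scheme \<Rightarrow> ('k, 'b, 'n) graded_algebra_scheme \<Rightarrow> ('a \<Rightarrow> 'b) set"
  where "graded_algebra_iso A B = {\<phi> \<in> ring_iso A B.
    (\<forall>a. \<forall>x\<in>carrier A. \<phi> (a \<odot>\<^bsub>A\<^esub> x) = a \<odot>\<^bsub>B\<^esub> \<phi> x) \<and>
    (\<forall>n. \<phi> ` component A n = component B n)}"

definition graded_isomorphic ::
  "('k, 'a, 'm) graded_algebra_scheme \<Rightarrow> ('k, 'b, 'n) graded_algebra_scheme \<Rightarrow> bool"
  where "graded_isomorphic A B \<longleftrightarrow> graded_algebra_iso A B \<noteq> {}"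

abbreviation TV :: "'k::field tensor ring"
  where "TV \<equiv> ring_of_type_algebra"

text \<open>
  The quotient of \<open>TV\<close> by the two-sided ideal generated by \<open>S\<close>. Its elements are the
  cosets of that ideal, so two such quotients are equal iff the ideals are equal.
\<close>

definition TV_quotient :: "'k::field tensor set \<Rightarrow> ('k, 'k tensor set) graded_algebra"
  where "TV_quotient S = (let I = Idl\<^bsub>TV\<^esub> S; Q = TV Quot I in
    \<lparr>carrier = carrier Q, monoid.mult = monoid.mult Q, monoid.one = monoid.one Q,
     ring.zero = ring.zero Q, add = add Q,
     module.smult = (\<lambda>a C. \<Union>t\<in>C. I +>\<^bsub>TV\<^esub> (a *\<^sub>k t)),
     component = (\<lambda>n. (\<lambda>t. I +>\<^bsub>TV\<^esub> t) ` tens n)\<rparr>)"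

definition jacobi_algebra :: "'k::field tensor \<Rightarrow> ('k, 'k tensor set) graded_algebra"
  where "jacobi_algebra w = TV_quotient {cyc_deriv Lx w, cyc_deriv Ly w, cyc_deriv Lz w}"

definition poisson_bracket :: "('k::field spoly \<Rightarrow> 'k spoly \<Rightarrow> 'k spoly) \<Rightarrow> bool"
  where "poisson_bracket B \<longleftrightarrow>
    (\<forall>f g h. B (f + g) h = B f h + B g h) \<and>
    (\<forall>f g h. B f (g + h) = B f g + B f h) \<and>
    (\<forall>a f g. B (a *\<^sub>k f) g = a *\<^sub>k B f g) \<and>
    (\<forall>a f g. B f (a *\<^sub>k g) = a *\<^sub>k B f g) \<and>
    (\<forall>f. B f f = 0) \<and>
    (\<forall>f g h. B f (g * h) = B f g * h + g * B f h) \<and>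
    (\<forall>f g h. B f (B g h) + B g (B h f) + B h (B f g) = 0)"

definition quadratic_poisson :: "('k::field spoly \<Rightarrow> 'k spoly \<Rightarrow> 'k spoly) \<Rightarrow> bool"
  where "quadratic_poisson B \<longleftrightarrow>
    poisson_bracket B \<and> (\<forall>u\<in>spow 1. \<forall>v\<in>spow 1. B u v \<in> spow 2)"

text \<open>
  \<open>bar\<close> identifies the two copies \<open>tens 1\<close> and \<open>spow 1\<close> of \<open>V\<close>.
\<close>

definition relations ::
  "('k::field spoly \<Rightarrow> 'k spoly \<Rightarrow> 'k spoly) \<Rightarrow> 'k \<Rightarrow> 'k tensor set"
  where "relations B l =
    {u * v - v * u - l *\<^sub>k hat 2 (B (bar u) (bar v)) | u v. u \<in> tens 1 \<and> v \<in> tens 1}"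

definition A_poisson ::
  "('k::field spoly \<Rightarrow> 'k spoly \<Rightarrow> 'k spoly) \<Rightarrow> 'k \<Rightarrow> ('k, 'k tensor set) graded_algebra"
  where "A_poisson B l = TV_quotient (relations B l)"

definition partial :: "letter \<Rightarrow> 'k::field spoly \<Rightarrow> 'k spoly"
  where "partial a = lin_ext (\<lambda>m.
    Poly_Mapping.single (m - Poly_Mapping.single a 1) (of_nat (Poly_Mapping.lookup m a)))"

text \<open>
  The bracket \<open>{\<cdot>,\<cdot>}\<^sub>f\<close>, written as the biderivation determined by its values
  on the generators; see \<open>quadratic_poisson_bracket\<close> and \<open>bracket_unique\<close> below.
\<close>

definition bracket :: "'k::field spoly \<Rightarrow> 'k spoly \<Rightarrow> 'k spoly \<Rightarrow> 'k spoly"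
  where "bracket f g h =
    partial Lz f * (partial Lx g * partial Ly h - partial Ly g * partial Lx h) +
    partial Lx f * (partial Ly g * partial Lz h - partial Lz g * partial Ly h) +
    partial Ly f * (partial Lz g * partial Lx h - partial Lx g * partial Lz h)"

definition A_cubic :: "'k::field spoly \<Rightarrow> 'k \<Rightarrow> ('k, 'k tensor set) graded_algebra"
  where "A_cubic f l = A_poisson (bracket f) l"

lemma lookup_scale: "Poly_Mapping.lookup (a *\<^sub>k p) b = a * Poly_Mapping.lookup p b"
  by (simp add: scale_def Poly_Mapping.map.rep_eq when_def)

lemma scale_conv_mult: "a *\<^sub>k p = Poly_Mapping.single 0 a * p"
  for p :: "'b::monoid_add \<Rightarrow>\<^sub>0 'k::comm_ring_1"
  by (simp add: scale_def mult_map_scale_conv_mult)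

lemma scale_single: "a *\<^sub>k Poly_Mapping.single b c = Poly_Mapping.single b (a * c)"
  by (rule poly_mapping_eqI) (simp add: lookup_scale lookup_single when_def)

lemma lin_ext_superset:
  assumes "finite A" "Poly_Mapping.keys p \<subseteq> A"
  shows "lin_ext g p = (\<Sum>b\<in>A. Poly_Mapping.lookup p b *\<^sub>k g b)"
  unfolding lin_ext_def
  by (rule sum.mono_neutral_left)
     (use assms in \<open>auto simp: in_keys_iff scale_def intro!: poly_mapping_eqI
        simp: Poly_Mapping.map.rep_eq when_def\<close>)

lemma lin_ext_add: "lin_ext g (p + q) = lin_ext g p + lin_ext g q"
proof -
  let ?A = "Poly_Mapping.keys p \<union> Poly_Mapping.keys q"
  have "finite ?A" "Poly_Mapping.keys (p + q) \<subseteq> ?A"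
    using keys_add[of p q] by auto
  then show ?thesis
    by (simp add: lin_ext_superset[of ?A] flip: sum.distrib)
       (intro sum.cong refl poly_mapping_eqI, simp add: lookup_scale lookup_add algebra_simps)
qed

lemma lin_ext_single: "lin_ext g (Poly_Mapping.single b a) = a *\<^sub>k g b"
  by (subst lin_ext_superset[of "{b}"]) auto

lemma single_induct [case_names zero single add]:
  assumes "P 0" "\<And>b a. P (Poly_Mapping.single b a)"
    and "\<And>p q. P p \<Longrightarrow> P q \<Longrightarrow> P (p + q)"
  shows "P (p :: 'b \<Rightarrow>\<^sub>0 'k::comm_ring_1)"
proof -
  have "P (\<Sum>b\<in>A. Poly_Mapping.single b (Poly_Mapping.lookup p b))" if "finite A" for A
    using that by induction (use assms in auto)
  then have "P (\<Sum>b\<in>Poly_Mapping.keys p. Poly_Mapping.single b (Poly_Mapping.lookup p b))"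
    by simp
  moreover have "(\<Sum>b\<in>Poly_Mapping.keys p. Poly_Mapping.single b (Poly_Mapping.lookup p b)) = p"
    by (rule poly_mapping_eqI)
       (auto simp: lookup_sum lookup_single when_def in_keys_iff)
  ultimately show ?thesis by simp
qed

lemma partial_add: "partial a (p + q) = partial a p + partial a q"
  by (simp add: partial_def lin_ext_add)

lemma partial_single: "partial a (Poly_Mapping.single m c) =
    Poly_Mapping.single (m - Poly_Mapping.single a 1) (of_nat (Poly_Mapping.lookup m a) * c)"
  by (simp add: partial_def lin_ext_single scale_single mult.commute)

lemma partial_zero: "partial a 0 = 0"
  using partial_add[of a 0 0] by simp

lemma partial_diff: "partial a (p - q) = partial a p - partial a q"
  using partial_add[of a "p - q" q] by simp

lemma partial_minus: "partial a (- q) = - partial a q"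
  using partial_diff[of a 0 q] by (simp add: partial_zero)

lemma minus_single_add:
  assumes "Poly_Mapping.lookup m a \<noteq> 0"
  shows "m - Poly_Mapping.single a (Suc 0) + n = m + n - Poly_Mapping.single a (Suc 0)"
  by (rule poly_mapping_eqI)
     (use assms in \<open>auto simp: lookup_add lookup_minus lookup_single when_def\<close>)

lemma partial_mult: "partial a (p * q) = partial a p * q + p * partial a q"
proof (induction p rule: single_induct)
  case (single m c)
  show ?case
  proof (induction q rule: single_induct)
    case (single n d)
    let ?e = "Poly_Mapping.single a (1::nat)"
    have 1: "partial a (Poly_Mapping.single m c) * Poly_Mapping.single n d =
       Poly_Mapping.single (m + n - ?e) (of_nat (Poly_Mapping.lookup m a) * c * d)"
      by (cases "Poly_Mapping.lookup m a = 0")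
         (simp_all add: partial_single mult_single minus_single_add)
    have 2: "Poly_Mapping.single m c * partial a (Poly_Mapping.single n d) =
       Poly_Mapping.single (m + n - ?e) (of_nat (Poly_Mapping.lookup n a) * c * d)"
      using minus_single_add[of n a m]
      by (cases "Poly_Mapping.lookup n a = 0")
         (simp_all add: partial_single mult_single add.commute mult_ac)
    show ?case unfolding 1 2
      by (simp add: mult_single partial_single lookup_add algebra_simps flip: single_add)
  qed (simp_all add: partial_add partial_zero algebra_simps)
qed (simp_all add: partial_add partial_zero algebra_simps)

lemma partial_commute: "partial a (partial b p) = partial b (partial a p)"
proof (induction p rule: single_induct)
  case (single m c)
  have "m - Poly_Mapping.single b (Suc 0) - Poly_Mapping.single a (Suc 0) =
      m - Poly_Mapping.single a (Suc 0) - Poly_Mapping.single b (Suc 0)"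
    by (rule poly_mapping_eqI) (simp add: lookup_minus)
  then show ?case
    by (cases "a = b")
       (simp_all add: partial_single lookup_minus lookup_single when_def mult_ac)
qed (simp_all add: partial_add partial_zero)

lemma partial_scale: "partial a (c *\<^sub>k p) = c *\<^sub>k partial a p"
  by (simp add: scale_conv_mult partial_mult partial_single)

lemma scale_mult_left: "(c *\<^sub>k p) * q = c *\<^sub>k (p * q)"
  and scale_mult_right: "p * (c *\<^sub>k q) = c *\<^sub>k (p * q)"
  and scale_add: "c *\<^sub>k (p + q) = c *\<^sub>k p + c *\<^sub>k q"
  and scale_diff: "c *\<^sub>k (p - q) = c *\<^sub>k p - c *\<^sub>k q"
  for p q :: "'k::field spoly"
  by (simp_all add: scale_conv_mult algebra_simps)

lemma partial_svar: "partial a (svar b) = (if a = b then 1 else 0)"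
  by (auto simp: svar_def partial_single lookup_single when_def)

abbreviation mdeg :: "(letter \<Rightarrow>\<^sub>0 nat) \<Rightarrow> nat"
  where "mdeg m \<equiv> (\<Sum>a\<in>Poly_Mapping.keys m. Poly_Mapping.lookup m a)"

lemma mdeg_conv: "mdeg m = (\<Sum>a\<in>{Lx,Ly,Lz}. Poly_Mapping.lookup m a)"
proof (rule sum.mono_neutral_left)
  show "Poly_Mapping.keys m \<subseteq> {Lx, Ly, Lz}"
    using UNIV_letter by blast
qed (auto simp: in_keys_iff)

lemma spow_add: "p \<in> spow n \<Longrightarrow> q \<in> spow n \<Longrightarrow> p + q \<in> spow n"
  unfolding spow_def using keys_add[of p q] by blast

lemma spow_diff: "p \<in> spow n \<Longrightarrow> q \<in> spow n \<Longrightarrow> p - q \<in> spow n"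
  unfolding spow_def using keys_diff[of p q] by blast

lemma spow_mult: "p \<in> spow n \<Longrightarrow> q \<in> spow k \<Longrightarrow> p * q \<in> spow (n + k)"
  unfolding spow_def mdeg_conv using keys_mult[of p q]
  by (fastforce simp: lookup_add)

lemma partial_spow: 
  assumes "p \<in> spow n" shows "partial a p \<in> spow (n - 1)"
proof -
  have "Poly_Mapping.keys (partial a p) \<subseteq> (\<Union>m\<in>Poly_Mapping.keys p.
      Poly_Mapping.keys (Poly_Mapping.lookup p m *\<^sub>k Poly_Mapping.single (m - Poly_Mapping.single a 1)
        (of_nat (Poly_Mapping.lookup m a) :: 'a)))"
    unfolding partial_def lin_ext_def by (rule keys_sum)
  also have "\<dots> \<subseteq> {m. mdeg m = n - 1}"
  proof (rule UN_least)
    fix m assume "m \<in> Poly_Mapping.keys p"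
    then have "mdeg m = n" using assms by (simp add: spow_def)
    then show "Poly_Mapping.keys (Poly_Mapping.lookup p m *\<^sub>k Poly_Mapping.single
        (m - Poly_Mapping.single a 1) (of_nat (Poly_Mapping.lookup m a) :: 'a)) \<subseteq> {m. mdeg m = n - 1}"
      unfolding mdeg_conv scale_single
      by (cases "Poly_Mapping.lookup m a = 0"; cases a)
         (auto simp: lookup_minus lookup_single when_def)
  qed
  finally show ?thesis by (auto simp: spow_def)
qed

lemma derivation_unique:
  fixes D E :: "'k::field spoly \<Rightarrow> 'k spoly"
  assumes add: "\<And>p q. D (p + q) = D p + D q" "\<And>p q. E (p + q) = E p + E q"
    and scal: "\<And>a p. D (a *\<^sub>k p) = a *\<^sub>k D p" "\<And>a p. E (a *\<^sub>k p) = a *\<^sub>k E p"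
    and mult: "\<And>p q. D (p * q) = D p * q + p * D q" "\<And>p q. E (p * q) = E p * q + p * E q"
    and gen: "\<And>a. D (svar a) = E (svar a)"
  shows "D p = E p"
proof -
  have one: "D 1 = 0" "E 1 = 0"
    using mult(1)[of 1 1] mult(2)[of 1 1] by simp_all
  have mon: "D (Poly_Mapping.single m 1) = E (Poly_Mapping.single m 1)" for m
  proof (induction "mdeg m" arbitrary: m)
    case 0
    then have "m = 0" by (auto simp: in_keys_iff intro!: poly_mapping_eqI)
    then show ?case using one by simp
  next
    case (Suc n)
    then obtain a where a: "Poly_Mapping.lookup m a \<noteq> 0"
      by (metis in_keys_iff nat.distinct(1) sum.neutral)
    define m' where "m' = m - Poly_Mapping.single a 1"
    have m: "m = Poly_Mapping.single a 1 + m'"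
      by (rule poly_mapping_eqI)
         (use a in \<open>auto simp: m'_def lookup_add lookup_minus lookup_single when_def\<close>)
    have "n = mdeg m'"
      using Suc(2) unfolding m mdeg_conv
      by (cases a) (auto simp: lookup_add lookup_single when_def)
    from Suc(1)[OF this] have "D (Poly_Mapping.single m' 1) = E (Poly_Mapping.single m' 1)" .
    moreover have "Poly_Mapping.single m (1::'k) = svar a * Poly_Mapping.single m' 1"
      unfolding m by (simp add: svar_def mult_single)
    ultimately show ?case by (simp add: mult gen)
  qed
  have zero: "D 0 = 0" "E 0 = 0"
    using add(1)[of 0 0] add(2)[of 0 0] by simp_all
  show ?thesis
  proof (induction p rule: single_induct)
    case (single m c)
    show ?case
      using scal[of c "Poly_Mapping.single m 1"] mon by (simp add: scale_single)
  qed (simp_all add: add zero)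
qed

lemma bracket_add_left: "bracket f (p + q) g = bracket f p g + bracket f q g"
  and bracket_add_right: "bracket f g (p + q) = bracket f g p + bracket f g q"
  and bracket_mult_left: "bracket f (p * q) g = bracket f p g * q + p * bracket f q g"
  and bracket_mult_right: "bracket f g (p * q) = bracket f g p * q + p * bracket f g q"
  and bracket_scale_left: "bracket f (a *\<^sub>k p) g = a *\<^sub>k bracket f p g"
  and bracket_scale_right: "bracket f g (a *\<^sub>k p) = a *\<^sub>k bracket f g p"
  and bracket_antisym: "bracket f p q = - bracket f q p"
  and bracket_self: "bracket f p p = 0"
  by (simp_all add: bracket_def partial_add partial_mult partial_scale scale_mult_left
      scale_mult_right scale_add scale_diff algebra_simps)

lemma bracket_minus_right: "bracket f g (- p) = - bracket f g p"
  by (simp add: bracket_def partial_minus algebra_simps)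

lemma bracket_jacobi:
  "bracket f g (bracket f h l) + bracket f h (bracket f l g) + bracket f l (bracket f g h) = 0"
proof -
  define jac where "jac g h l = bracket f g (bracket f h l) + bracket f h (bracket f l g) +
    bracket f l (bracket f g h)" for g h l
  have cyc: "jac g h l = jac h l g" for g h l
    by (simp add: jac_def algebra_simps)
  have der: "jac g h l = 0" if "\<And>a. jac g h (svar a) = 0" for g h l
  proof (rule derivation_unique[of "jac g h" "\<lambda>_. 0"])
    show "jac g h (p * q) = jac g h p * q + p * jac g h q" for p q
      unfolding jac_def bracket_mult_left bracket_mult_right bracket_add_right
        bracket_antisym[of f p g] bracket_antisym[of f q g] bracket_minus_right
      by (simp add: algebra_simps)
    show "jac g h (svar a) = 0" for a by (rule that)
  qed (simp_all add: jac_def bracket_add_left bracket_add_right bracket_scale_left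
      bracket_scale_right scale_add, simp_all add: scale_conv_mult)
  have c: "partial Ly (partial Lx p) = partial Lx (partial Ly p)"
     "partial Lz (partial Lx p) = partial Lx (partial Lz p)"
     "partial Lz (partial Ly p) = partial Ly (partial Lz p)" for p :: "'a spoly"
    by (rule partial_commute)+
  have "jac (svar a) (svar b) (svar d) = 0" for a b d
    unfolding jac_def
    by (cases a; cases b; cases d)
       (simp_all add: bracket_def partial_svar partial_zero partial_minus c algebra_simps)
  then have 1: "jac (svar a) (svar b) l = 0" for a b l
    by (rule der)
  have 2: "jac h (svar a) l = 0" for h a l
    by (rule der, subst cyc, rule 1)
  have "jac g h l = 0" for g h l
    by (rule der, subst cyc, rule 2)
  then show ?thesis by (simp add: jac_def)
qed

lemma bracket_poisson: "poisson_bracket (bracket f)"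
  unfolding poisson_bracket_def
  using bracket_jacobi[of f]
  by (simp add: bracket_add_left bracket_add_right bracket_mult_right bracket_scale_left
      bracket_scale_right bracket_self)

lemma quadratic_poisson_bracket:
  assumes "f \<in> spow 3"
  shows "quadratic_poisson (bracket f)"
    and "bracket f (svar Lx) (svar Ly) = partial Lz f"
    and "bracket f (svar Ly) (svar Lz) = partial Lx f"
    and "bracket f (svar Lz) (svar Lx) = partial Ly f"
proof -
  have "bracket f u v \<in> spow 2" if u: "u \<in> spow 1" and v: "v \<in> spow 1" for u v
  proof -
    have [intro!]: "p * (partial a u * partial b v - partial c u * partial d v) \<in> spow 2"
      if "p \<in> spow 2" for p a b c d
    proof -
      have "partial a u * partial b v \<in> spow (0 + 0)" for a b
        using partial_spow[OF u] partial_spow[OF v] by (intro spow_mult) auto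
      then show ?thesis
        using spow_mult[OF that, of _ 0] spow_diff by (metis add_0 add_0_right)
    qed
    have "partial a f \<in> spow 2" for a
      using partial_spow[OF assms, of a] by simp
    then show ?thesis unfolding bracket_def by (intro spow_add) auto
  qed
  then show "quadratic_poisson (bracket f)"
    by (simp add: quadratic_poisson_def bracket_poisson)
qed (simp_all add: bracket_def partial_svar)

lemma poisson_bracket_derivation:
  assumes "poisson_bracket B"
  shows "B f (g + h) = B f g + B f h" "B f (a *\<^sub>k g) = a *\<^sub>k B f g"
    "B f (g * h) = B f g * h + g * B f h" "B f f = 0"
  using assms unfolding poisson_bracket_def by blast+

lemma poisson_bracket_antisym:
  assumes "poisson_bracket B" shows "B g h = - B h g"
proof -
  have "B (g + h) (g + h) = 0" "B g g = 0" "B h h = 0"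
    using assms by (auto simp: poisson_bracket_def)
  moreover have "B (g + h) (g + h) = B g (g + h) + B h (g + h)" "B g (g + h) = B g g + B g h"
    "B h (g + h) = B h g + B h h"
    using assms unfolding poisson_bracket_def by blast+
  ultimately have "B g h + B h g = 0"
    by simp
  then show ?thesis by (simp add: eq_neg_iff_add_eq_0)
qed

lemma bracket_unique:
  assumes B: "poisson_bracket B"
    and gen: "B (svar Lx) (svar Ly) = partial Lz f" "B (svar Ly) (svar Lz) = partial Lx f"
      "B (svar Lz) (svar Lx) = partial Ly f"
  shows "B = bracket f"
proof (intro ext)
  fix g h
  note P = bracket_poisson[of f]
  note D = poisson_bracket_derivation[OF B] poisson_bracket_derivation[OF P]
  note antisym = poisson_bracket_antisym[OF B] poisson_bracket_antisym[OF P]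
  have G: "B (svar a) (svar b) = bracket f (svar a) (svar b)" for a b
    using gen D(4)[of "svar a"] antisym(1)[of "svar a" "svar b"]
    by (cases a; cases b) (simp_all add: bracket_def partial_svar)
  have 1: "B (svar a) h = bracket f (svar a) h" for a h
    by (rule derivation_unique[of "B (svar a)"]; (rule D G)?)
  have 2: "B h (svar a) = bracket f h (svar a)" for a h
    unfolding antisym(1)[of h "svar a"] antisym(2)[of h "svar a"] 1 ..
  show "B g h = bracket f g h"
    by (rule derivation_unique[of "B g"]; (rule D 2)?)
qed

end

theory Submission
  imports Defs
begin

text \<open>
  On a symmetric cubic tensor the cyclic derivative is the polarized partial derivative, because
  both are symmetric tensors with the same image in \<open>S\<^sup>2V\<close>; on \<open>w0\<close> it gives the commutators.
  Moreover \<open>cyc_deriv a w\<close> depends only on \<open>cyc_sym w = full_sym w + mu w *\<^sub>k w0\<close>. So for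
  \<open>mu w \<noteq> 0\<close> the relations of \<open>J(w)\<close> are those of \<open>A\<^sub>f\<close> up to a scalar.

  If \<open>mu w = 0\<close>, all relations of \<open>J(w)\<close> are symmetric tensors. Under a graded isomorphism from
  \<open>J(w)\<close> to \<open>A\<^sub>\<pi>\<close> the generators \<open>x, y\<close> correspond to linearly independent \<open>X, Y \<in> V\<close>, and the
  relation between \<open>x\<close> and \<open>y\<close> pulls back to \<open>XY - YX\<close> minus a symmetric tensor. Hence
  \<open>XY - YX\<close> is both symmetric and antisymmetric, so it vanishes, which makes \<open>X, Y\<close> dependent.
\<close>

section \<open>Tensors and linear extension\<close>

text \<open>Homogeneous elements are those supported on the words of one length or the monomials of
  one degree; taking that set as \<open>K\<close> gives induction within a degree.\<close>

lemma single_induct_on [consumes 1, case_names zero single add]: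
  fixes p :: "'b \<Rightarrow>\<^sub>0 'k::comm_ring_1"
  assumes "Poly_Mapping.keys p \<subseteq> K" and "P 0"
    and "\<And>b a. b \<in> K \<Longrightarrow> P (Poly_Mapping.single b a)"
    and "\<And>p q. P p \<Longrightarrow> P q \<Longrightarrow> P (p + q)"
  shows "P p"
proof -
  have "P (\<Sum>b\<in>A. Poly_Mapping.single b (Poly_Mapping.lookup p b))" if "finite A" "A \<subseteq> K" for A
    using that by induction (use assms in auto)
  then have "P (\<Sum>b\<in>Poly_Mapping.keys p. Poly_Mapping.single b (Poly_Mapping.lookup p b))"
    using assms(1) by simp
  moreover have "(\<Sum>b\<in>Poly_Mapping.keys p. Poly_Mapping.single b (Poly_Mapping.lookup p b)) = p"
    by (rule poly_mapping_eqI)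
       (auto simp: lookup_sum lookup_single when_def in_keys_iff)
  ultimately show ?thesis by simp
qed

lemma scale_add_right: "c *\<^sub>k (p + q) = c *\<^sub>k p + c *\<^sub>k q"
  and scale_diff_right: "c *\<^sub>k (p - q) = c *\<^sub>k p - c *\<^sub>k q"
  and scale_scale: "c *\<^sub>k d *\<^sub>k p = (c * d) *\<^sub>k p"
  and scale_zero_right: "c *\<^sub>k 0 = (0 :: 'b \<Rightarrow>\<^sub>0 'k::comm_ring_1)"
  and scale_zero_left: "0 *\<^sub>k p = 0"
  and scale_one: "1 *\<^sub>k p = p"
  by (rule poly_mapping_eqI; simp add: lookup_scale lookup_add lookup_minus algebra_simps)+

lemma scale_sum_right: "c *\<^sub>k (\<Sum>i\<in>A. p i) = (\<Sum>i\<in>A. c *\<^sub>k p i)"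
  by (induction A rule: infinite_finite_induct) (simp_all add: scale_zero_right scale_add_right)

lemma mult_scale_left: "(c *\<^sub>k p) * q = c *\<^sub>k (p * q)"
  for p q :: "'b::monoid_add \<Rightarrow>\<^sub>0 'k::comm_ring_1"
  by (simp add: scale_conv_mult mult.assoc)

text \<open>Scalars are the elements \<open>single 0 c\<close>, and these are central even when the
  exponents do not commute.\<close>

lemma mult_scale_right: "p * (c *\<^sub>k q) = c *\<^sub>k (p * q)"
  for p q :: "'b::monoid_add \<Rightarrow>\<^sub>0 'k::comm_ring_1"
proof -
  have "p * Poly_Mapping.single 0 c = Poly_Mapping.single 0 c * p"
    by (induction p rule: single_induct) (simp_all add: mult_single mult.commute algebra_simps)
  then show ?thesis by (simp add: scale_conv_mult flip: mult.assoc)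
qed

lemma lin_ext_zero: "lin_ext g 0 = 0"
  using lin_ext_add[of g 0 0] by simp

lemma lin_ext_scale: "lin_ext g (a *\<^sub>k p) = a *\<^sub>k lin_ext g p"
  by (induction p rule: single_induct)
     (simp_all add: lin_ext_zero scale_zero_right scale_single lin_ext_single scale_scale
        scale_add_right lin_ext_add)

lemma lin_ext_diff: "lin_ext g (p - q) = lin_ext g p - lin_ext g q"
  using lin_ext_add[of g "p - q" q] by simp

lemma lin_ext_sum: "lin_ext g (\<Sum>i\<in>A. p i) = (\<Sum>i\<in>A. lin_ext g (p i))"
  by (induction A rule: infinite_finite_induct) (simp_all add: lin_ext_zero lin_ext_add)

lemma single_eq_scale_word: "Poly_Mapping.single w c = c *\<^sub>k word w"
  by (simp add: word_def scale_single)

lemma lin_ext_word: "lin_ext g (word w) = g w"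
  by (simp add: word_def lin_ext_single scale_one)

lemma lookup_word: "Poly_Mapping.lookup (word w) v = (if v = w then 1 else 0)"
  by (auto simp: word_def lookup_single when_def)

lemma word_mult: "word u * word v = word (u @ v)"
  by (simp add: word_def mult_single plus_list_def)

section \<open>Homogeneous tensors\<close>

lemma tens_iff: "t \<in> tens n \<longleftrightarrow> (\<forall>w. length w \<noteq> n \<longrightarrow> Poly_Mapping.lookup t w = 0)"
  by (auto simp: tens_def in_keys_iff)

lemma tens_add: "s \<in> tens n \<Longrightarrow> t \<in> tens n \<Longrightarrow> s + t \<in> tens n"
  and tens_diff: "s \<in> tens n \<Longrightarrow> t \<in> tens n \<Longrightarrow> s - t \<in> tens n"
  and tens_scale: "t \<in> tens n \<Longrightarrow> c *\<^sub>k t \<in> tens n"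
  and tens_zero: "0 \<in> tens n"
  and tens_word: "word w \<in> tens n \<longleftrightarrow> length w = n"
  by (auto simp: tens_iff lookup_add lookup_minus lookup_scale lookup_word)

lemma tens_sum: "(\<And>i. i \<in> A \<Longrightarrow> t i \<in> tens n) \<Longrightarrow> (\<Sum>i\<in>A. t i) \<in> tens n"
  by (induction A rule: infinite_finite_induct) (auto simp: tens_zero tens_add)

lemma tens_mult: "s \<in> tens m \<Longrightarrow> t \<in> tens n \<Longrightarrow> s * t \<in> tens (m + n)"
  unfolding tens_def using keys_mult[of s t] by (fastforce simp: plus_list_def)

lemma tens_lin_ext: "(\<And>w. w \<in> Poly_Mapping.keys p \<Longrightarrow> g w \<in> tens n) \<Longrightarrow> lin_ext g p \<in> tens n"
  unfolding lin_ext_def by (intro tens_sum tens_scale) auto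

lemma tens_induct [consumes 1, case_names zero word add]:
  assumes "t \<in> tens n" and "P 0" and "\<And>w c. length w = n \<Longrightarrow> P (c *\<^sub>k word w)"
    and "\<And>s t. P s \<Longrightarrow> P t \<Longrightarrow> P (s + t)"
  shows "P t"
proof -
  have "Poly_Mapping.keys t \<subseteq> {w. length w = n}"
    using assms(1) by (auto simp: tens_def)
  then show ?thesis
    by (induction t rule: single_induct_on) (auto simp: single_eq_scale_word assms)
qed

lemma tens_eqI:
  assumes "s \<in> tens n" "t \<in> tens n"
    and "\<And>w. length w = n \<Longrightarrow> Poly_Mapping.lookup s w = Poly_Mapping.lookup t w"
  shows "s = t"
  by (rule poly_mapping_eqI) (metis assms tens_iff)

section \<open>Symmetric tensors and polarization\<close>

text \<open>The action moves factors forward, so coefficients are pulled back and the inverse in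
  \<open>perm_act\<close> cancels. A word \<open>v\<close> whose length differs from that of
  \<open>w\<close> contributes to neither side.\<close>

lemma lookup_perm_act:
  assumes "\<sigma> permutes {..<length w}"
  shows "Poly_Mapping.lookup (perm_act \<sigma> t) w = Poly_Mapping.lookup t (permute_list \<sigma> w)"
proof (induction t rule: single_induct)
  case (single v c)
  have "w = permute_list (inv_into UNIV \<sigma>) v \<longleftrightarrow> permute_list \<sigma> w = v"
  proof (cases "length v = length w")
    case True
    have "inv_into UNIV \<sigma> permutes {..<length w}"
      using assms by (rule permutes_inv)
    then have "permute_list (inv_into UNIV \<sigma>) (permute_list \<sigma> w) = w"
      "permute_list \<sigma> (permute_list (inv_into UNIV \<sigma>) v) = v"
      using assms True
      by (simp_all add: permutes_inv_o flip: permute_list_compose)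
    then show ?thesis by auto
  qed (auto dest: arg_cong[where f = length])
  then show ?case
    by (auto simp: perm_act_def lin_ext_single lookup_scale lookup_word lookup_single when_def)
qed (simp_all add: perm_act_def lin_ext_zero lin_ext_add lookup_add)

lemma tens_perm_act: "t \<in> tens n \<Longrightarrow> perm_act \<sigma> t \<in> tens n"
  unfolding perm_act_def by (rule tens_lin_ext) (simp add: tens_word, simp add: tens_def)

text \<open>The words of length \<open>n\<close> with given letters form one orbit of the symmetric
  group, so invariance means that a coefficient depends only on the multiset of letters.
  Coefficients at other lengths vanish.\<close>

lemma sym_tens_iff:
  "t \<in> sym_tens n \<longleftrightarrow> t \<in> tens n \<and>
     (\<forall>v w. mset v = mset w \<longrightarrow> Poly_Mapping.lookup t v = Poly_Mapping.lookup t w)"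
proof (cases "t \<in> tens n")
  case True
  have "(\<forall>\<sigma>. \<sigma> permutes {..<n} \<longrightarrow> perm_act \<sigma> t = t) \<longleftrightarrow>
     (\<forall>v w. mset v = mset w \<longrightarrow> Poly_Mapping.lookup t v = Poly_Mapping.lookup t w)"
  proof safe
    fix v w :: "letter list" assume *: "\<forall>\<sigma>. \<sigma> permutes {..<n} \<longrightarrow> perm_act \<sigma> t = t" "mset v = mset w"
    show "Poly_Mapping.lookup t v = Poly_Mapping.lookup t w"
    proof (cases "length w = n")
      case False
      moreover have "length v = length w" using *(2) by (rule mset_eq_length)
      ultimately show ?thesis using True by (simp add: tens_iff)
    next
      case True
      obtain p where "p permutes {..<length w}" "permute_list p w = v"
        using mset_eq_permutation[OF *(2)] .
      then show ?thesis using True * lookup_perm_act[of p w t] by simp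
    qed
  next
    fix \<sigma> assume *: "\<forall>v w. mset v = mset w \<longrightarrow> Poly_Mapping.lookup t v = Poly_Mapping.lookup t w"
      "\<sigma> permutes {..<n}"
    show "perm_act \<sigma> t = t"
      by (rule tens_eqI[OF tens_perm_act[OF True] True])
         (use *(2) in \<open>simp add: lookup_perm_act *(1)[rule_format, OF mset_permute_list]\<close>)
  qed
  then show ?thesis using True by (simp add: sym_tens_def)
qed (simp add: sym_tens_def)

lemma sym_tensI:
  assumes "t \<in> tens n"
    and "\<And>v w. mset v = mset w \<Longrightarrow> Poly_Mapping.lookup t v = Poly_Mapping.lookup t w"
  shows "t \<in> sym_tens n"
  unfolding sym_tens_iff using assms by blast

lemma sym_tens_tens: "t \<in> sym_tens n \<Longrightarrow> t \<in> tens n"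
  and sym_tens_lookup: "t \<in> sym_tens n \<Longrightarrow> mset v = mset w \<Longrightarrow>
    Poly_Mapping.lookup t v = Poly_Mapping.lookup t w"
  unfolding sym_tens_iff by blast+

lemma sym_tens_add:
  assumes "s \<in> sym_tens n" "t \<in> sym_tens n"
  shows "s + t \<in> sym_tens n"
  by (intro sym_tensI tens_add assms[THEN sym_tens_tens])
     (metis lookup_add assms[THEN sym_tens_lookup])

lemma sym_tens_scale:
  assumes "t \<in> sym_tens n"
  shows "c *\<^sub>k t \<in> sym_tens n"
  by (intro sym_tensI tens_scale assms[THEN sym_tens_tens])
     (metis lookup_scale assms[THEN sym_tens_lookup])

lemma sym_tens_zero: "0 \<in> sym_tens n"
  by (intro sym_tensI tens_zero) simp

section \<open>Averaging over the symmetric group\<close>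

definition symmetrizer :: "nat \<Rightarrow> 'k::field tensor \<Rightarrow> 'k tensor"
  where "symmetrizer n t = (1 / of_nat (fact n)) *\<^sub>k (\<Sum>\<sigma> | \<sigma> permutes {..<n}. perm_act \<sigma> t)"

lemma tens_symmetrizer: "t \<in> tens n \<Longrightarrow> symmetrizer n t \<in> tens n"
  unfolding symmetrizer_def by (intro tens_scale tens_sum tens_perm_act)

lemma lookup_symmetrizer:
  assumes "length w = n"
  shows "Poly_Mapping.lookup (symmetrizer n t) w =
    (\<Sum>\<sigma> | \<sigma> permutes {..<n}. Poly_Mapping.lookup t (permute_list \<sigma> w)) / of_nat (fact n)"
  using assms by (simp add: symmetrizer_def lookup_scale lookup_sum lookup_perm_act)

lemma symmetrizer_add: "symmetrizer n (s + t) = symmetrizer n s + symmetrizer n t"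
  and symmetrizer_scale: "symmetrizer n (c *\<^sub>k t) = c *\<^sub>k symmetrizer n t"
  and symmetrizer_zero: "symmetrizer n 0 = 0"
  by (simp_all add: symmetrizer_def perm_act_def lin_ext_add lin_ext_scale lin_ext_zero sum.distrib
      scale_add_right scale_zero_right scale_scale mult.commute flip: scale_sum_right)

text \<open>If \<open>v\<close> is \<open>w\<close> permuted by \<open>p\<close>, the sum for
  \<open>v\<close> is the sum for \<open>w\<close> reindexed by left composition with
  \<open>p\<close>.\<close>

lemma symmetrizer_sym_tens:
  assumes "t \<in> tens n"
  shows "symmetrizer n t \<in> sym_tens n"
proof (rule sym_tensI)
  fix v w :: "letter list" assume *: "mset v = mset w"
  note len = mset_eq_length[OF this]
  show "Poly_Mapping.lookup (symmetrizer n t) v = Poly_Mapping.lookup (symmetrizer n t) w"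
  proof (cases "length w = n")
    case True
    obtain p where p: "p permutes {..<length w}" "permute_list p w = v"
      using mset_eq_permutation[OF *] .
    have "(\<Sum>\<sigma> | \<sigma> permutes {..<n}. Poly_Mapping.lookup t (permute_list \<sigma> v)) =
      (\<Sum>\<sigma> | \<sigma> permutes {..<n}. Poly_Mapping.lookup t (permute_list (p \<circ> \<sigma>) w))"
      using True by (intro sum.cong) (auto simp: permute_list_compose simp flip: p(2))
    also have "\<dots> = (\<Sum>\<sigma> | \<sigma> permutes {..<n}. Poly_Mapping.lookup t (permute_list \<sigma> w))"
      using setum_permutations_compose_left[OF p(1)[unfolded True], symmetric] .
    finally show ?thesis using True len by (simp add: lookup_symmetrizer)
  qed (use tens_symmetrizer[OF assms] len in \<open>simp add: tens_iff\<close>)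
qed (rule tens_symmetrizer[OF assms])

text \<open>All n! summands agree on a symmetric tensor. Where n! vanishes in the field the factor
  would be \<open>1 / 0 = 0\<close>, hence the second hypothesis.\<close>

lemma symmetrizer_id:
  assumes "t \<in> sym_tens n" and "of_nat (fact n) \<noteq> (0 :: 'k::field)"
  shows "symmetrizer n t = (t :: 'k tensor)"
proof (rule tens_eqI[of _ n])
  fix w :: "letter list" assume w: "length w = n"
  have "Poly_Mapping.lookup t (permute_list \<sigma> w) = Poly_Mapping.lookup t w"
    if "\<sigma> permutes {..<n}" for \<sigma>
    using that w by (intro sym_tens_lookup[OF assms(1)]) simp
  then show "Poly_Mapping.lookup (symmetrizer n t) w = Poly_Mapping.lookup t w"
    using assms(2) w by (simp add: lookup_symmetrizer card_permutations)
qed (use assms in \<open>simp_all add: tens_symmetrizer sym_tens_tens\<close>)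

text \<open>Permuting the input, instead of the word at which a coefficient is read, reindexes the
  average by right composition. Hence symmetrization depends only on the commutative monomial of a
  word.\<close>

lemma symmetrizer_word_cong:
  assumes "mset v = mset w" "length w = n"
  shows "symmetrizer n (word v) = (symmetrizer n (word w) :: 'k::field tensor)"
proof (rule tens_eqI[of _ n])
  fix u :: "letter list" assume u: "length u = n"
  obtain p where p: "p permutes {..<n}" "permute_list p w = v"
    using mset_eq_permutation[OF assms(1)] assms(2) by metis
  have inv: "inv_into UNIV p permutes {..<n}" using p(1) by (rule permutes_inv)
  have *: "permute_list \<sigma> u = v \<longleftrightarrow> permute_list (\<sigma> \<circ> inv_into UNIV p) u = w" if "\<sigma> permutes {..<n}" for \<sigma>
  proof -
    have "permute_list p (permute_list (inv_into UNIV p) x) = x"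
      "permute_list (inv_into UNIV p) (permute_list p x) = x" if "length x = n" for x :: "letter list"
      using p(1) inv that by (simp_all add: permutes_inv_o flip: permute_list_compose)
    from this(1)[of "permute_list \<sigma> u"] this(2)[of w] assms(2) u
    have "permute_list p (permute_list (inv_into UNIV p) (permute_list \<sigma> u)) = permute_list \<sigma> u"
      "permute_list (inv_into UNIV p) (permute_list p w) = w"
      by simp_all
    moreover have "permute_list (\<sigma> \<circ> inv_into UNIV p) u =
        permute_list (inv_into UNIV p) (permute_list \<sigma> u)"
      using inv u by (simp add: permute_list_compose)
    ultimately show ?thesis using p(2) by metis
  qed
  have "(\<Sum>\<sigma> | \<sigma> permutes {..<n}. Poly_Mapping.lookup (word v :: 'k tensor) (permute_list \<sigma> u)) =
    (\<Sum>\<sigma> | \<sigma> permutes {..<n}. Poly_Mapping.lookup (word w) (permute_list (\<sigma> \<circ> inv_into UNIV p) u))"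
    by (intro sum.cong) (auto simp: lookup_word *)
  also have "\<dots> = (\<Sum>\<sigma> | \<sigma> permutes {..<n}. Poly_Mapping.lookup (word w) (permute_list \<sigma> u))"
    by (rule sum_permutations_compose_right[OF inv, symmetric])
  finally show "Poly_Mapping.lookup (symmetrizer n (word v) :: 'k tensor) u =
      Poly_Mapping.lookup (symmetrizer n (word w)) u"
    using u by (simp add: lookup_symmetrizer)
qed (use assms mset_eq_length[OF assms(1)] in \<open>auto intro!: tens_symmetrizer simp: tens_word\<close>)

section \<open>From words to commutative monomials\<close>

lemma bar_add: "bar (s + t) = bar s + bar t"
  and bar_scale: "bar (c *\<^sub>k t) = c *\<^sub>k bar t"
  and bar_zero: "bar 0 = 0"
  and bar_word: "bar (word w) = prod_list (map svar w)"
  and bar_sum: "bar (\<Sum>i\<in>A. T i) = (\<Sum>i\<in>A. bar (T i))"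
  by (simp_all add: bar_def lin_ext_add lin_ext_scale lin_ext_zero lin_ext_word lin_ext_sum)

text \<open>A chosen preimage of a monomial under \<open>bar\<close>, with its letters in the order
  x, y, z.\<close>

definition monomial_word :: "(letter \<Rightarrow>\<^sub>0 nat) \<Rightarrow> letter list"
  where "monomial_word m = replicate (Poly_Mapping.lookup m Lx) Lx @
    replicate (Poly_Mapping.lookup m Ly) Ly @ replicate (Poly_Mapping.lookup m Lz) Lz"

definition exponent :: "letter list \<Rightarrow> (letter \<Rightarrow>\<^sub>0 nat)"
  where "exponent w = (\<Sum>a\<leftarrow>w. Poly_Mapping.single a 1)"

lemma lookup_exponent: "Poly_Mapping.lookup (exponent w) a = count (mset w) a"
  by (induction w) (auto simp: exponent_def lookup_add lookup_single when_def)

lemma exponent_eq_iff: "exponent v = exponent w \<longleftrightarrow> mset v = mset w"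
  by (metis lookup_exponent multiset_eq_iff poly_mapping_eqI)

lemma exponent_monomial_word: "exponent (monomial_word m) = m"
proof (rule poly_mapping_eqI)
  show "Poly_Mapping.lookup (exponent (monomial_word m)) a = Poly_Mapping.lookup m a" for a
    by (cases a) (simp_all add: lookup_exponent monomial_word_def)
qed

lemma length_monomial_word: "length (monomial_word m) = mdeg m"
  by (simp add: monomial_word_def mdeg_conv)

lemma prod_list_svar: "prod_list (map svar w) = Poly_Mapping.single (exponent w) 1"
  by (induction w) (simp_all add: exponent_def svar_def mult_single flip: single_one)

lemma mset_monomial_word: "mset (monomial_word (exponent w)) = mset w"
  using exponent_monomial_word exponent_eq_iff by blast

lemma bar_perm_act:
  assumes "t \<in> tens n" "\<sigma> permutes {..<n}"
  shows "bar (perm_act \<sigma> t) = bar t"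
  using assms(1)
proof (induction t rule: tens_induct)
  case (word w c)
  have "inv_into UNIV \<sigma> permutes {..<length w}"
    using assms(2) word by (simp add: permutes_inv)
  then have "exponent (permute_list (inv_into UNIV \<sigma>) w) = exponent w"
    by (simp add: exponent_eq_iff)
  then show ?case
    by (simp add: perm_act_def lin_ext_scale lin_ext_word bar_scale bar_word prod_list_svar)
qed (simp_all add: perm_act_def lin_ext_zero lin_ext_add bar_add)

lemma bar_symmetrizer:
  assumes "t \<in> tens n" and "of_nat (fact n) \<noteq> (0 :: 'k::field)"
  shows "bar (symmetrizer n t) = bar (t :: 'k tensor)"
proof -
  have "bar (symmetrizer n t) = (1 / of_nat (fact n)) *\<^sub>k (\<Sum>\<sigma> | \<sigma> permutes {..<n}. bar t)"
    using assms(1) by (simp add: symmetrizer_def bar_scale bar_sum bar_perm_act)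
  also have "\<dots> = bar t"
    using assms(2)
    by (intro poly_mapping_eqI) (simp only: lookup_scale lookup_sum, simp add: card_permutations)
  finally show ?thesis .
qed

text \<open>A linear formula for the inverse of \<open>bar\<close> on symmetric tensors. It is
  additive on all of SV, whereas \<open>hat n\<close> is controlled only on the image of
  \<open>sym_tens n\<close>.\<close>

definition polarization :: "nat \<Rightarrow> 'k::field spoly \<Rightarrow> 'k tensor"
  where "polarization n = lin_ext (\<lambda>m. symmetrizer n (word (monomial_word m)))"

lemma polarization_add: "polarization n (p + q) = polarization n p + polarization n q"
  and polarization_scale: "polarization n (c *\<^sub>k p) = c *\<^sub>k polarization n p"
  and polarization_zero: "polarization n 0 = 0"
  by (simp_all add: polarization_def lin_ext_add lin_ext_scale lin_ext_zero)

text \<open>The word chosen for a monomial may be replaced by any word with the same letters, by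
  \<open>symmetrizer_word_cong\<close>. If n! is invertible, this makes
  \<open>polarization n\<close> a left inverse of \<open>bar\<close> on symmetric tensors.\<close>

lemma polarization_bar:
  assumes "t \<in> tens n"
  shows "polarization n (bar t) = symmetrizer n t"
  using assms
proof (induction t rule: tens_induct)
  case (word w c)
  have "symmetrizer n (word (monomial_word (exponent w))) = (symmetrizer n (word w) :: 'a tensor)"
    by (intro symmetrizer_word_cong mset_monomial_word word)
  then show ?case
    by (simp add: bar_scale bar_word prod_list_svar symmetrizer_scale polarization_def
        lin_ext_scale lin_ext_single scale_one)
qed (simp_all add: bar_add bar_zero polarization_add polarization_zero symmetrizer_add symmetrizer_zero)

text \<open>Surjectivity of \<open>bar\<close>: symmetrizing the chosen word does not change its
  image in SV.\<close>

lemma polarization_sym_tens_bar: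
  assumes "p \<in> spow n" and "of_nat (fact n) \<noteq> (0 :: 'k::field)"
  shows "polarization n (p :: 'k spoly) \<in> sym_tens n \<and> bar (polarization n p) = p"
proof -
  have "Poly_Mapping.keys p \<subseteq> {m. mdeg m = n}"
    using assms(1) by (auto simp: spow_def)
  then show ?thesis
  proof (induction p rule: single_induct_on)
    case (single m c)
    have w: "(word (monomial_word m) :: 'k tensor) \<in> tens n"
      using single by (simp add: tens_word length_monomial_word)
    have "bar (word (monomial_word m)) = Poly_Mapping.single m (1::'k)"
      by (simp add: bar_word prod_list_svar exponent_monomial_word)
    with w show ?case
      using assms(2)
      by (simp add: polarization_def lin_ext_single sym_tens_scale symmetrizer_sym_tens
          bar_scale bar_symmetrizer scale_single)
  qed (simp_all add: polarization_add polarization_zero sym_tens_zero sym_tens_add bar_zero bar_add)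
qed

lemma hat_bar:
  assumes "t \<in> sym_tens n" and "of_nat (fact n) \<noteq> (0 :: 'k::field)"
  shows "hat n (bar t) = (t :: 'k tensor)"
  unfolding hat_def
proof (rule the_inv_into_f_f)
  show "inj_on bar (sym_tens n :: 'k tensor set)"
    by (rule inj_on_inverseI[of _ "polarization n"])
       (simp add: polarization_bar sym_tens_tens symmetrizer_id assms(2))
qed (fact assms)

lemma hat_eq_polarization:
  assumes "p \<in> spow n" and "of_nat (fact n) \<noteq> (0 :: 'k::field)"
  shows "hat n (p :: 'k spoly) = polarization n p"
  using polarization_sym_tens_bar[OF assms] hat_bar assms(2) by metis

section \<open>Cyclic derivatives\<close>

lemma cyc_deriv_add: "cyc_deriv a (s + t) = cyc_deriv a s + cyc_deriv a t"
  and cyc_deriv_diff: "cyc_deriv a (s - t) = cyc_deriv a s - cyc_deriv a t"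
  and cyc_deriv_scale: "cyc_deriv a (c *\<^sub>k t) = c *\<^sub>k cyc_deriv a t"
  and cyc_deriv_zero: "cyc_deriv a 0 = 0"
  by (simp_all add: cyc_deriv_def lin_ext_add lin_ext_diff lin_ext_scale lin_ext_zero)

lemma cyc_deriv_word3: "cyc_deriv a (word [b, c, d]) =
  (if a = b then word [c, d] else 0) + (if a = c then word [d, b] else 0) +
  (if a = d then word [b, c] else 0)"
proof -
  \<comment> \<open>The three factorizations differ in the length of \<open>u\<close>, so a repeated
    letter is counted once per position.\<close>
  have "{(u, v). [b, c, d] = u @ [a] @ v} =
    (if a = b then {([], [c, d])} else {}) \<union> (if a = c then {([b], [d])} else {}) \<union>
    (if a = d then {([b, c], [])} else {})"
    by (auto simp: Cons_eq_append_conv)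
  then show ?thesis
    unfolding cyc_deriv_def lin_ext_word by (subst sum.union_disjoint | simp | force)+
qed

lemma length_3_cases:
  assumes "length w = 3"
  obtains b c d where "w = [b, c, d]"
  using assms by (auto simp: numeral_3_eq_3 length_Suc_conv)

lemma length_2_cases:
  assumes "length w = 2"
  obtains b c where "w = [b, c]"
  using assms by (auto simp: numeral_2_eq_2 length_Suc_conv)

lemma cyc_deriv_tens:
  assumes "t \<in> tens 3"
  shows "cyc_deriv a t \<in> tens 2"
  using assms
proof (induction t rule: tens_induct)
  case (word w c)
  then show ?case
    by (elim length_3_cases) (auto simp: cyc_deriv_scale cyc_deriv_word3 tens_word tens_zero
        intro!: tens_scale tens_add)
qed (auto simp: cyc_deriv_zero cyc_deriv_add tens_zero tens_add)

text \<open>The words with \<open>[b, c]\<close> in their derivative are the rotations of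
  \<open>[a, b, c]\<close>; if these coincide, the multiplicities agree as well.\<close>

lemma lookup_cyc_deriv:
  assumes "t \<in> tens 3"
  shows "Poly_Mapping.lookup (cyc_deriv a t) [b, c] = Poly_Mapping.lookup t [a, b, c] +
    Poly_Mapping.lookup t [c, a, b] + Poly_Mapping.lookup t [b, c, a]"
  using assms
proof (induction t rule: tens_induct)
  case (word w k)
  then obtain p q r where w: "w = [p, q, r]" by (rule length_3_cases)
  have *: "Poly_Mapping.lookup (if P then word v else 0) u = (if P \<and> u = v then 1 else 0)"
    for P and u v :: "letter list"
    by (simp add: lookup_word)
  have "a = p \<and> [b, c] = [q, r] \<longleftrightarrow> [a, b, c] = w" "a = q \<and> [b, c] = [r, p] \<longleftrightarrow> [c, a, b] = w"
    "a = r \<and> [b, c] = [p, q] \<longleftrightarrow> [b, c, a] = w"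
    by (auto simp: w)
  then show ?case
    by (simp only: w cyc_deriv_scale cyc_deriv_word3 lookup_scale lookup_word lookup_add * distrib_left)
qed (simp_all add: cyc_deriv_zero cyc_deriv_add lookup_add)

lemma sym_tens_2_iff:
  "t \<in> sym_tens 2 \<longleftrightarrow> t \<in> tens 2 \<and>
     (\<forall>b c. Poly_Mapping.lookup t [b, c] = Poly_Mapping.lookup t [c, b])"
proof (safe intro!: sym_tensI sym_tens_tens)
  fix v w :: "letter list" 
  assume *: "t \<in> tens 2" "\<forall>b c. Poly_Mapping.lookup t [b, c] = Poly_Mapping.lookup t [c, b]"
    "mset v = mset w"
  have "length v = length w" using *(3) by (rule mset_eq_length)
  show "Poly_Mapping.lookup t v = Poly_Mapping.lookup t w"
  proof (cases "length w = 2")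
    case True
    with \<open>length v = length w\<close> have "length v = 2" by simp
    then obtain b c where v: "v = [b, c]" by (rule length_2_cases)
    obtain b' c' where w: "w = [b', c']" using True by (rule length_2_cases)
    have "b = b' \<and> c = c' \<or> b = c' \<and> c = b'"
      using *(3) by (auto simp: v w add_eq_conv_ex)
    then show ?thesis using *(2) v w by metis
  qed (use *(1) \<open>length v = length w\<close> in \<open>simp add: tens_iff\<close>)
next
  fix b c assume "t \<in> sym_tens 2"
  then show "Poly_Mapping.lookup t [b, c] = Poly_Mapping.lookup t [c, b]"
    by (rule sym_tens_lookup) simp
qed

text \<open>Exchanging \<open>b\<close> and \<open>c\<close> turns the rotations of
  \<open>[a, b, c]\<close> into those of \<open>[a, c, b]\<close>, which have the same letters and
  hence the same coefficients.\<close>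

lemma cyc_deriv_sym_tens:
  assumes "t \<in> sym_tens 3"
  shows "cyc_deriv a t \<in> sym_tens 2"
proof -
  have "Poly_Mapping.lookup t [a, b, c] = Poly_Mapping.lookup t [a, c, b]"
    "Poly_Mapping.lookup t [c, a, b] = Poly_Mapping.lookup t [b, a, c]"
    "Poly_Mapping.lookup t [b, c, a] = Poly_Mapping.lookup t [c, b, a]" for b c
    by (rule sym_tens_lookup[OF assms]; simp)+
  then show ?thesis
    using assms by (simp add: sym_tens_2_iff cyc_deriv_tens sym_tens_tens lookup_cyc_deriv)
qed

text \<open>Once the letters commute, the order \<open>v @ u\<close> is irrelevant, and deleting
  each occurrence of \<open>a\<close> in turn is the Leibniz rule.\<close>

lemma bar_cyc_deriv:
  assumes "t \<in> tens 3"
  shows "bar (cyc_deriv a t) = partial a (bar t)"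
  using assms
proof (induction t rule: tens_induct)
  case (word w c)
  then show ?case
    by (elim length_3_cases)
       (auto simp: cyc_deriv_scale cyc_deriv_word3 bar_scale bar_word bar_add bar_zero partial_scale
        partial_mult partial_svar algebra_simps)
qed (simp_all add: cyc_deriv_zero cyc_deriv_add bar_add bar_zero partial_add partial_zero)

lemma nonzero_if_CHAR_neq:
  assumes "CHAR('k::field) \<noteq> 2" and "CHAR('k) \<noteq> 3"
  shows "(2 :: 'k) \<noteq> 0" "(3 :: 'k) \<noteq> 0" "of_nat (fact 2) \<noteq> (0 :: 'k)"
    "of_nat (fact 3) \<noteq> (0 :: 'k)"
proof -
  \<comment> \<open>If \<open>of_nat p = 0\<close>, the characteristic divides the prime
    \<open>p\<close>; it is never 1, so it is \<open>p\<close>.\<close>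
  have "of_nat p \<noteq> (0 :: 'k)" if "prime p" "CHAR('k) \<noteq> p" for p
    using that prime_nat_iff CHAR_not_1' by (auto simp: of_nat_eq_0_iff_char_dvd)
  from this[of 2] this[of 3] assms show *: "(2 :: 'k) \<noteq> 0" "(3 :: 'k) \<noteq> 0"
    by simp_all
  have "of_nat (fact 2) = (2 :: 'k)" "of_nat (fact 3) = (2 * 3 :: 'k)"
    by (simp_all add: fact_numeral)
  then show "of_nat (fact 2) \<noteq> (0 :: 'k)" "of_nat (fact 3) \<noteq> (0 :: 'k)"
    using * by (metis, metis mult_eq_0_iff)
qed

section \<open>The decomposition of cyclically symmetric cubic tensors\<close>

lemma full_sym_eq_symmetrizer: "full_sym t = symmetrizer 3 t"
  by (simp add: full_sym_def symmetrizer_def fact_numeral)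

lemma lookup_perm_act_cycle:
  assumes "t \<in> tens 3"
  shows "Poly_Mapping.lookup (perm_act (cycle_of_list [0, 1, 2]) t) [b, c, d] =
      Poly_Mapping.lookup t [c, d, b]"
    "Poly_Mapping.lookup (perm_act (cycle_of_list [2, 1, 0]) t) [b, c, d] =
      Poly_Mapping.lookup t [d, b, c]"
proof -
  have "cycle_of_list [0, 1, 2] permutes {..<length [b, c, d]}"
    "cycle_of_list [2, 1, 0] permutes {..<length [b, c, d]}"
    by (auto intro!: permutes_compose permutes_swap_id)
  then show "Poly_Mapping.lookup (perm_act (cycle_of_list [0, 1, 2]) t) [b, c, d] =
      Poly_Mapping.lookup t [c, d, b]"
    "Poly_Mapping.lookup (perm_act (cycle_of_list [2, 1, 0]) t) [b, c, d] =
      Poly_Mapping.lookup t [d, b, c]"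
    by (simp_all add: lookup_perm_act permute_list_def transpose_def upt_rec)
qed

lemma tens_cyc_sym: "t \<in> tens 3 \<Longrightarrow> cyc_sym t \<in> tens 3"
  unfolding cyc_sym_def by (intro tens_scale tens_add tens_perm_act)

lemma lookup_cyc_sym:
  assumes "t \<in> tens 3"
  shows "Poly_Mapping.lookup (cyc_sym t) [b, c, d] = (Poly_Mapping.lookup t [b, c, d] +
    Poly_Mapping.lookup t [c, d, b] + Poly_Mapping.lookup t [d, b, c]) / 3"
  \<comment> \<open>The cycles stay folded and \<open>1\<close> is not rewritten to
    \<open>Suc 0\<close>, so that \<open>lookup_perm_act_cycle\<close> matches.\<close>
  using assms by (simp add: cyc_sym_def lookup_scale lookup_add lookup_perm_act_cycle
      del: cycle_of_list.simps One_nat_def)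

lemma lookup_full_sym:
  "Poly_Mapping.lookup (full_sym t) [b, c, d] = (Poly_Mapping.lookup t [b, c, d] +
    Poly_Mapping.lookup t [c, d, b] + Poly_Mapping.lookup t [d, b, c] +
    Poly_Mapping.lookup t [c, b, d] + Poly_Mapping.lookup t [b, d, c] +
    Poly_Mapping.lookup t [d, c, b]) / 6"
proof -
  have *: "{..<3::nat} = insert 0 (insert 1 (insert 2 {}))" by auto
  have "(\<Sum>\<sigma> | \<sigma> permutes {..<3}. Poly_Mapping.lookup t (permute_list \<sigma> [b, c, d])) =
    Poly_Mapping.lookup t [b, c, d] +
    Poly_Mapping.lookup t [c, d, b] + Poly_Mapping.lookup t [d, b, c] +
    Poly_Mapping.lookup t [c, b, d] + Poly_Mapping.lookup t [b, d, c] +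
    Poly_Mapping.lookup t [d, c, b]"
    unfolding * by (simp add: sum_over_permutations_insert permute_list_def transpose_def upt_rec)
  then show ?thesis by (simp add: full_sym_eq_symmetrizer lookup_symmetrizer fact_numeral)
qed

text \<open>A coefficient of \<open>cyc_deriv a t\<close> sums over the rotations of a word, so
  after averaging over rotations each of its three terms is a third of that same sum.\<close>

lemma cyc_deriv_cyc_sym:
  assumes "t \<in> tens 3" "(3 :: 'k::field) \<noteq> 0"
  shows "cyc_deriv a (cyc_sym t) = cyc_deriv a (t :: 'k tensor)"
proof (rule tens_eqI[of _ 2])
  fix w :: "letter list" assume "length w = 2"
  then obtain b c where "w = [b, c]" by (rule length_2_cases)
  moreover have thirds: "s / 3 + (s / 3 + s / 3) = s" for s :: 'k
    using assms(2) by (simp add: flip: add_divide_distrib)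
  ultimately show "Poly_Mapping.lookup (cyc_deriv a (cyc_sym t)) w = Poly_Mapping.lookup (cyc_deriv a t) w"
    by (simp only: lookup_cyc_deriv tens_cyc_sym lookup_cyc_sym assms(1) add_ac thirds)
qed (use assms in \<open>auto intro: cyc_deriv_tens tens_cyc_sym\<close>)

lemma tens_w0: "w0 \<in> tens 3"
  unfolding w0_def by (intro tens_scale tens_add tens_diff) (simp_all add: tens_word)

lemma lookup_w0: "Poly_Mapping.lookup w0 [b, c, d] =
  (if [b, c, d] \<in> {[Lx, Ly, Lz], [Ly, Lz, Lx], [Lz, Lx, Ly]} then 1 / 3
   else if [b, c, d] \<in> {[Lz, Ly, Lx], [Lx, Lz, Ly], [Ly, Lx, Lz]} then - 1 / 3 else 0)"
  by (auto simp: w0_def lookup_scale lookup_add lookup_minus lookup_word)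

text \<open>The rotations of a word with a repeated letter already exhaust its rearrangements, so
  the difference lives on words with three distinct letters. There it takes opposite values on even
  and odd rearrangements of xyz, as \<open>w0\<close> does.\<close>

lemma cyc_sym_minus_full_sym:
  assumes "t \<in> tens 3" and "(2 :: 'k::field) \<noteq> 0" "(3 :: 'k) \<noteq> 0"
  shows "cyc_sym t - full_sym t = mu t *\<^sub>k (w0 :: 'k tensor)"
proof -
  have nonzero: "(6 :: 'k) \<noteq> 0" "(18 :: 'k) \<noteq> 0"
    using assms mult_eq_0_iff[of "2::'k" 3] mult_eq_0_iff[of "2 * 3::'k" 3] by simp_all
  \<comment> \<open>With E and O the sums over even and odd rearrangements of xyz, the coefficient
    of xyz in the difference is E/3 - (E + O)/6 = (E - O)/6. It is 1/3 in \<open>w0\<close>, which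
    leaves (E - O)/2.\<close>
  define a where "a = (Poly_Mapping.lookup t [Lx, Ly, Lz] + Poly_Mapping.lookup t [Ly, Lz, Lx] +
      Poly_Mapping.lookup t [Lz, Lx, Ly] - Poly_Mapping.lookup t [Lz, Ly, Lx] -
      Poly_Mapping.lookup t [Lx, Lz, Ly] - Poly_Mapping.lookup t [Ly, Lx, Lz]) / 2"
  have "cyc_sym t - full_sym t = a *\<^sub>k w0"
  proof (rule tens_eqI[of _ 3])
    fix w :: "letter list" assume "length w = 3"
    then obtain b c d where "w = [b, c, d]" by (rule length_3_cases)
    then show "Poly_Mapping.lookup (cyc_sym t - full_sym t) w = Poly_Mapping.lookup (a *\<^sub>k w0) w"
      using assms nonzero
      by (cases b; cases c; cases d)
         (simp_all add: lookup_minus lookup_scale lookup_cyc_sym lookup_full_sym lookup_w0 a_def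
            field_simps)
  qed (use assms in \<open>auto simp: full_sym_eq_symmetrizer
        intro: tens_scale tens_w0 tens_diff tens_symmetrizer tens_cyc_sym\<close>)
  \<comment> \<open>Uniqueness of the scalar, which the description in \<open>mu\<close> requires,
    is read off at xyz.\<close>
  moreover have "a = b" if "a *\<^sub>k w0 = b *\<^sub>k (w0 :: 'k tensor)" for a b
    using arg_cong[OF that, of "\<lambda>t. Poly_Mapping.lookup t [Lx, Ly, Lz]"] assms(3)
    by (simp add: lookup_scale lookup_w0)
  ultimately show ?thesis
    unfolding mu_def by (metis (mono_tags, lifting) theI)
qed

text \<open>Indexed by the absent letter and oriented cyclically, so that
  \<open>comm_relation a\<close> goes with \<open>partial a f\<close>.\<close>

definition comm_relation :: "letter \<Rightarrow> 'k::field tensor"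
  where "comm_relation a = (case a of
    Lx \<Rightarrow> word [Ly, Lz] - word [Lz, Ly] | Ly \<Rightarrow> word [Lz, Lx] - word [Lx, Lz] |
    Lz \<Rightarrow> word [Lx, Ly] - word [Ly, Lx])"

lemma tens_comm_relation: "comm_relation a \<in> tens 2"
  by (cases a) (auto simp: comm_relation_def tens_word intro!: tens_diff)

text \<open>Each word of the commutator comes from the three rotations of one word in
  \<open>w0\<close>, and these have the same coefficient, 1/3 or -1/3.\<close>

lemma cyc_deriv_w0:
  assumes "(3 :: 'k::field) \<noteq> 0"
  shows "cyc_deriv a w0 = (comm_relation a :: 'k tensor)"
proof (rule tens_eqI[of _ 2])
  fix w :: "letter list" assume "length w = 2"
  then obtain b c where "w = [b, c]" by (rule length_2_cases)
  moreover have sum: "1 / 3 + 2 / 3 = (1 :: 'k)"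
    using assms by (simp flip: add_divide_distrib)
  moreover have "- (1 / 3) - 2 / 3 = (- 1 :: 'k)"
    using arg_cong[OF sum, of uminus] by simp
  ultimately show "Poly_Mapping.lookup (cyc_deriv a w0) w =
      Poly_Mapping.lookup (comm_relation a :: 'k tensor) w"
    by (cases a; cases b; cases c)
       (simp_all add: lookup_cyc_deriv tens_w0 lookup_w0 comm_relation_def lookup_minus lookup_word
         add_ac)
qed (use cyc_deriv_tens tens_w0 tens_comm_relation in auto)

section \<open>Quotients of the tensor algebra\<close>

lemma ring_of_type_algebra_simps:
  "carrier ring_of_type_algebra = UNIV" "x \<otimes>\<^bsub>ring_of_type_algebra\<^esub> y = x * y"
  "x \<oplus>\<^bsub>ring_of_type_algebra\<^esub> y = x + y" "\<zero>\<^bsub>ring_of_type_algebra\<^esub> = 0"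
  for x y :: "'a::ring_1"
  by (simp_all add: ring_of_type_algebra_def)

lemma ring_ring_of_type_algebra: "ring (ring_of_type_algebra :: 'a::ring_1 ring)"
proof (intro ringI abelian_groupI monoidI)
  show "\<exists>y\<in>carrier ring_of_type_algebra. y \<oplus>\<^bsub>ring_of_type_algebra\<^esub> x = \<zero>\<^bsub>ring_of_type_algebra\<^esub>"
    for x :: 'a
    by (rule bexI[of _ "- x"]) (simp_all add: ring_of_type_algebra_simps)
qed (simp_all add: ring_of_type_algebra_def algebra_simps)

lemma a_inv_ring_of_type_algebra: "\<ominus>\<^bsub>ring_of_type_algebra\<^esub> x = - x" for x :: "'a::ring_1"
  by (rule abelian_group.minus_equality[OF ring.is_abelian_group[OF ring_ring_of_type_algebra]])
     (simp_all add: ring_of_type_algebra_simps)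

lemma a_minus_ring_of_type_algebra: "x \<ominus>\<^bsub>ring_of_type_algebra\<^esub> y = x - y" for x y :: "'a::ring_1"
  by (simp add: a_minus_def a_inv_ring_of_type_algebra ring_of_type_algebra_simps)

lemma ideal_ring_of_type_algebraI:
  fixes I :: "'a::ring_1 set"
  assumes "0 \<in> I" and "\<And>x y. x \<in> I \<Longrightarrow> y \<in> I \<Longrightarrow> x + y \<in> I"
    and "\<And>x y. x \<in> I \<Longrightarrow> y * x \<in> I" and "\<And>x y. x \<in> I \<Longrightarrow> x * y \<in> I"
  shows "ideal I ring_of_type_algebra"
proof (rule idealI[OF ring_ring_of_type_algebra])
  have "- x \<in> I" if "x \<in> I" for x
    using assms(3)[OF that, of "- 1"] by simp
  then show "subgroup I (add_monoid ring_of_type_algebra)"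
    using assms(1,2) a_inv_ring_of_type_algebra[where 'a = 'a, unfolded a_inv_def]
    by (intro subgroup.intro) (simp_all add: ring_of_type_algebra_simps)
qed (simp_all add: ring_of_type_algebra_simps assms)

lemma ideal_ring_of_type_algebraD:
  fixes I :: "'a::ring_1 set"
  assumes "ideal I ring_of_type_algebra"
  shows "0 \<in> I" "x \<in> I \<Longrightarrow> y \<in> I \<Longrightarrow> x + y \<in> I" "x \<in> I \<Longrightarrow> - x \<in> I"
    "x \<in> I \<Longrightarrow> z * x \<in> I" "x \<in> I \<Longrightarrow> x * z \<in> I"
proof -
  interpret ideal I "ring_of_type_algebra" by fact
  show "0 \<in> I" "x \<in> I \<Longrightarrow> y \<in> I \<Longrightarrow> x + y \<in> I" "x \<in> I \<Longrightarrow> - x \<in> I"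
    "x \<in> I \<Longrightarrow> z * x \<in> I" "x \<in> I \<Longrightarrow> x * z \<in> I"
    using additive_subgroup.zero_closed[OF is_additive_subgroup]
      additive_subgroup.a_closed[OF is_additive_subgroup, of x y]
      additive_subgroup.a_inv_closed[OF is_additive_subgroup, of x]
      I_l_closed[of x z] I_r_closed[of x z]
    by (simp_all add: ring_of_type_algebra_simps a_inv_ring_of_type_algebra)
qed

lemma ideal_scale: "ideal I TV \<Longrightarrow> t \<in> I \<Longrightarrow> c *\<^sub>k t \<in> I"
  for I :: "'k::field tensor set"
  by (simp add: scale_conv_mult ideal_ring_of_type_algebraD(4))

lemma coset_eq_iff:
  fixes I :: "'a::ring_1 set"
  assumes "ideal I ring_of_type_algebra"
  shows "I +>\<^bsub>ring_of_type_algebra\<^esub> s = I +>\<^bsub>ring_of_type_algebra\<^esub> t \<longleftrightarrow> s - t \<in> I"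
  using ring.quotient_eq_iff_same_a_r_cos[OF ring_ring_of_type_algebra assms, of s t]
  by (simp add: ring_of_type_algebra_simps a_minus_ring_of_type_algebra)

section \<open>Ideals and graded quotients of the tensor algebra\<close>

abbreviation TV_ideal :: "'k::field tensor set \<Rightarrow> 'k tensor set"
  where "TV_ideal S \<equiv> Idl\<^bsub>TV\<^esub> S"

abbreviation TV_class :: "'k::field tensor set \<Rightarrow> 'k tensor \<Rightarrow> 'k tensor set"
  where "TV_class S t \<equiv> TV_ideal S +>\<^bsub>TV\<^esub> t"

lemma ideal_TV_ideal: "ideal (TV_ideal S) TV"
  by (rule ring.genideal_ideal[OF ring_ring_of_type_algebra]) (simp add: ring_of_type_algebra_simps)

lemma TV_ideal_superset: "S \<subseteq> TV_ideal S"
  by (rule ring.genideal_self[OF ring_ring_of_type_algebra]) (simp add: ring_of_type_algebra_simps)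

lemma TV_ideal_minimal: "ideal I TV \<Longrightarrow> S \<subseteq> I \<Longrightarrow> TV_ideal S \<subseteq> I"
  by (rule ring.genideal_minimal[OF ring_ring_of_type_algebra])

text \<open>The quotient depends on its generators only through the ideal, so mutual membership
  yields equality of the algebras and not merely an isomorphism.\<close>

lemma TV_quotient_eqI:
  assumes "S \<subseteq> TV_ideal T" "T \<subseteq> TV_ideal S"
  shows "TV_quotient S = TV_quotient T"
proof -
  have "TV_ideal S = TV_ideal T"
    using assms ideal_TV_ideal by (intro equalityI TV_ideal_minimal)
  then show ?thesis by (simp add: TV_quotient_def)
qed

lemma TV_quotient_simps:
  "TV_class S t \<in> carrier (TV_quotient S)"
  "TV_class S s \<otimes>\<^bsub>TV_quotient S\<^esub> TV_class S t = TV_class S (s * t)"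
  "TV_class S s \<oplus>\<^bsub>TV_quotient S\<^esub> TV_class S t = TV_class S (s + t)"
  "a \<odot>\<^bsub>TV_quotient S\<^esub> TV_class S t = TV_class S (a *\<^sub>k t)"
  "component (TV_quotient S) n = TV_class S ` tens n"
proof -
  interpret ideal "TV_ideal S" TV by (rule ideal_TV_ideal)
  show "TV_class S t \<in> carrier (TV_quotient S)"
    "TV_class S s \<otimes>\<^bsub>TV_quotient S\<^esub> TV_class S t = TV_class S (s * t)"
    "TV_class S s \<oplus>\<^bsub>TV_quotient S\<^esub> TV_class S t = TV_class S (s + t)"
    using rcos_ring_hom ring_hom_closed[OF rcos_ring_hom, of t] ring_hom_mult[OF rcos_ring_hom, of s t]
      ring_hom_add[OF rcos_ring_hom, of s t]
    by (simp_all add: TV_quotient_def Let_def ring_of_type_algebra_simps)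
  show "component (TV_quotient S) n = TV_class S ` tens n"
    by (simp add: TV_quotient_def Let_def)
  \<comment> \<open>Scalar multiplication is a union over all representatives of a class; each
    yields the same coset, so the union is that coset.\<close>
  have "TV_class S (a *\<^sub>k u) = TV_class S (a *\<^sub>k t)" if "u \<in> TV_class S t" for u
  proof -
    have "TV_class S u = TV_class S t"
      using a_repr_independence[OF that _ a_subgroup] by (simp add: ring_of_type_algebra_simps)
    then have "a *\<^sub>k (u - t) \<in> TV_ideal S"
      by (intro ideal_scale ideal_TV_ideal) (simp add: coset_eq_iff ideal_TV_ideal)
    then show ?thesis by (simp add: coset_eq_iff ideal_TV_ideal scale_diff_right)
  qed
  moreover have "t \<in> TV_class S t"
    using a_rcos_self by (simp add: ring_of_type_algebra_simps)
  ultimately have "(\<Union>u\<in>TV_class S t. TV_class S (a *\<^sub>k u)) = TV_class S (a *\<^sub>k t)"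
    by (intro SUP_eq_const) blast+
  then show "a \<odot>\<^bsub>TV_quotient S\<^esub> TV_class S t = TV_class S (a *\<^sub>k t)"
    by (simp add: TV_quotient_def Let_def)
qed

section \<open>Jacobi algebras with a multiple of \<open>w0\<close>\<close>

lemma tens_1_induct [consumes 1, case_names zero word add]:
  assumes "t \<in> tens 1" and "P 0" and "\<And>a c. P (c *\<^sub>k word [a])"
    and "\<And>s t. P s \<Longrightarrow> P t \<Longrightarrow> P (s + t)"
  shows "P t"
  using assms(1)
  by (induction t rule: tens_induct) (auto simp: length_Suc_conv assms)

lemma bar_tens: "t \<in> tens n \<Longrightarrow> bar t \<in> spow n"
proof (induction t rule: tens_induct)
  case (word w c)
  have "bar (c *\<^sub>k word w) = Poly_Mapping.single (exponent w) c"
    by (simp add: bar_scale bar_word prod_list_svar scale_single)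
  moreover have "mdeg (exponent w) = length w"
    using length_monomial_word[of "exponent w"] mset_eq_length[OF mset_monomial_word, of w] by simp
  ultimately show ?case
    using word by (simp add: spow_def)
qed (auto simp: bar_zero bar_add spow_add, auto simp: spow_def)

text \<open>The common core of both equalities. The relation attached to \<open>u, v\<close> is
  bilinear and alternating, so three pairs of distinct letters generate all relations; the cyclic
  derivatives of \<open>w\<close> are these three up to the unit \<open>c\<close>.\<close>

theorem jacobi_algebra_eq_A_cubic:
  fixes g :: "'k::field spoly"
  assumes two: "of_nat (fact 2) \<noteq> (0 :: 'k)" and g: "g \<in> spow 3" and c: "c \<noteq> 0"
    and w: "\<And>a. cyc_deriv a w = c *\<^sub>k (comm_relation a - l *\<^sub>k hat 2 (partial a g))"
  shows "jacobi_algebra w = A_cubic g l"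
proof -
  define S where "S = {cyc_deriv Lx w, cyc_deriv Ly w, cyc_deriv Lz w}"
  \<comment> \<open>\<open>polarization\<close> replaces \<open>hat\<close>, so that
    \<open>rel\<close> is bilinear without any degree condition.\<close>
  define rel where "rel u v = u * v - v * u - l *\<^sub>k polarization 2 (bracket g (bar u) (bar v))"
    for u v :: "'k tensor"
  have quad: "quadratic_poisson (bracket g)"
    using g by (rule quadratic_poisson_bracket)
  have relations: "relations (bracket g) l = {rel u v | u v. u \<in> tens 1 \<and> v \<in> tens 1}"
    using quad hat_eq_polarization[OF _ two] bar_tens
    unfolding relations_def rel_def quadratic_poisson_def by (metis (no_types, lifting))
  have gen: "rel (word [Ly]) (word [Lz]) = comm_relation Lx - l *\<^sub>k hat 2 (partial Lx g)"
    "rel (word [Lz]) (word [Lx]) = comm_relation Ly - l *\<^sub>k hat 2 (partial Ly g)"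
    "rel (word [Lx]) (word [Ly]) = comm_relation Lz - l *\<^sub>k hat 2 (partial Lz g)"
    using quadratic_poisson_bracket(2-4)[OF g] hat_eq_polarization[OF _ two] partial_spow[OF g]
    by (simp_all add: rel_def comm_relation_def bar_word word_mult)
  have cyc: "cyc_deriv Lx w = c *\<^sub>k rel (word [Ly]) (word [Lz])"
    "cyc_deriv Ly w = c *\<^sub>k rel (word [Lz]) (word [Lx])"
    "cyc_deriv Lz w = c *\<^sub>k rel (word [Lx]) (word [Ly])"
    by (simp_all only: gen w)
  have rel_add: "rel (s + t) v = rel s v + rel t v" "rel v (s + t) = rel v s + rel v t" for s t v
    by (simp_all add: rel_def bar_add bracket_add_left bracket_add_right polarization_add
        scale_add_right algebra_simps)
  have rel_scale: "rel (a *\<^sub>k s) v = a *\<^sub>k rel s v" "rel v (a *\<^sub>k s) = a *\<^sub>k rel v s" for s v a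
    by (simp_all add: rel_def bar_scale bracket_scale_left bracket_scale_right polarization_scale
        scale_diff_right mult_scale_left mult_scale_right scale_scale mult.commute)
  have rel_zero: "rel 0 v = 0" "rel v 0 = 0" for v
    using rel_add(1)[of 0 0 v] rel_add(2)[of v 0 0] by simp_all
  have rel_self: "rel v v = 0" for v
    by (simp add: rel_def bracket_self polarization_zero scale_zero_right)
  have rel_antisym: "rel u v = - rel v u" for u v
    using rel_self[of "u + v"] unfolding rel_add rel_self[of u] rel_self[of v]
    by (simp add: eq_neg_iff_add_eq_0 add.commute)
  note I = ideal_ring_of_type_algebraD[OF ideal_TV_ideal[of S]]
  have base: "rel (word [a]) (word [b]) \<in> TV_ideal S" for a b
  proof -
    \<comment> \<open>Dividing by \<open>c\<close> recovers a relation from its multiple in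
      \<open>S\<close>.\<close>
    have "t \<in> TV_ideal S" if "s \<in> S" "s = c *\<^sub>k t" for s t
    proof -
      have "(1 / c) *\<^sub>k s \<in> TV_ideal S"
        using that(1) TV_ideal_superset by (intro ideal_scale[OF ideal_TV_ideal]) blast
      then show ?thesis using c that(2) by (simp add: scale_scale scale_one)
    qed
    from this[OF _ cyc(1)] this[OF _ cyc(2)] this[OF _ cyc(3)]
    have *: "rel (word [Ly]) (word [Lz]) \<in> TV_ideal S"
      "rel (word [Lz]) (word [Lx]) \<in> TV_ideal S" "rel (word [Lx]) (word [Ly]) \<in> TV_ideal S"
      unfolding S_def by blast+
    \<comment> \<open>The reversed pairs follow by antisymmetry, and a letter paired with itself
      gives 0.\<close>
    then have "- rel (word [Ly]) (word [Lz]) \<in> TV_ideal S"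
      "- rel (word [Lz]) (word [Lx]) \<in> TV_ideal S" "- rel (word [Lx]) (word [Ly]) \<in> TV_ideal S"
      by (auto intro: I(3))
    with * show ?thesis
      using rel_antisym[of "word [Lz]" "word [Ly]"] rel_antisym[of "word [Lx]" "word [Lz]"]
        rel_antisym[of "word [Ly]" "word [Lx]"]
      by (cases a; cases b) (simp_all add: rel_self I(1))
  qed
  \<comment> \<open>Bilinearity passes from letters to V, one argument at a time.\<close>
  have 1: "rel (word [a]) v \<in> TV_ideal S" if "v \<in> tens 1" for a v
    using that
    by (induction v rule: tens_1_induct)
       (simp_all add: rel_zero rel_add rel_scale I(1,2) ideal_scale[OF ideal_TV_ideal] base)
  have "rel u v \<in> TV_ideal S" if "u \<in> tens 1" "v \<in> tens 1" for u v
    using that(1)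
    by (induction u rule: tens_1_induct)
       (simp_all add: rel_zero rel_add rel_scale I(1,2) ideal_scale[OF ideal_TV_ideal] 1[OF that(2)])
  \<comment> \<open>Conversely, the elements of \<open>S\<close> are multiples of relations between
    letters.\<close>
  moreover have "rel (word [a]) (word [b]) \<in> relations (bracket g) l" for a b
    unfolding relations using tens_word[of "[_]" 1] by fastforce
  then have "S \<subseteq> TV_ideal (relations (bracket g) l)"
    using TV_ideal_superset by (auto simp: S_def cyc intro!: ideal_scale[OF ideal_TV_ideal])
  ultimately show ?thesis
    unfolding jacobi_algebra_def A_cubic_def A_poisson_def S_def[symmetric]
    by (intro TV_quotient_eqI) (auto simp: relations)
qed

section \<open>Jacobi algebras with symmetric relations\<close>

lemma lookup_mult_single_left: "Poly_Mapping.lookup (Poly_Mapping.single u c * t) v =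
  (if take (length u) v = u then c * Poly_Mapping.lookup t (drop (length u) v) else 0)"
  for t :: "'k::comm_ring_1 tensor"
proof (induction t rule: single_induct)
  case (single w d)
  have "u @ w = v \<longleftrightarrow> take (length u) v = u \<and> drop (length u) v = w"
    by (auto simp: append_eq_conv_conj)
  then show ?case
    by (auto simp: mult_single lookup_single when_def plus_list_def)
qed (auto simp: lookup_add algebra_simps)

text \<open>If \<open>v\<close> is shorter than \<open>u\<close>, the truncated difference is 0 and
  \<open>drop 0 v = v\<close> differs from \<open>u\<close>, so the value is 0 as it should
  be.\<close>

lemma lookup_mult_single_right: "Poly_Mapping.lookup (t * Poly_Mapping.single u c) v =
  (if drop (length v - length u) v = u then Poly_Mapping.lookup t (take (length v - length u) v) * c
   else 0)"
  for t :: "'k::comm_ring_1 tensor"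
proof (induction t rule: single_induct)
  case (single w d)
  have "w @ u = v \<longleftrightarrow> drop (length v - length u) v = u \<and> take (length v - length u) v = w"
    using append_take_drop_id[of "length v - length u" v] by fastforce
  then show ?case
    by (auto simp: mult_single lookup_single when_def plus_list_def)
qed (auto simp: lookup_add algebra_simps)

text \<open>An upper bound for any ideal generated by symmetric quadratic tensors: degrees above 2
  are left free, while degree 2 still records the symmetry.\<close>

definition quad_sym_ideal :: "'k::field tensor set"
  where "quad_sym_ideal = {t. (\<forall>w. length w < 2 \<longrightarrow> Poly_Mapping.lookup t w = 0) \<and>
    (\<forall>b c. Poly_Mapping.lookup t [b, c] = Poly_Mapping.lookup t [c, b])}"

text \<open>A nonempty word multiplies everything into degree at least 3, where no condition is
  imposed; the empty word only rescales.\<close>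

lemma ideal_quad_sym_ideal: "ideal (quad_sym_ideal :: 'k::field tensor set) TV"
proof (rule ideal_ring_of_type_algebraI)
  fix s t :: "'k tensor" assume t: "t \<in> quad_sym_ideal"
  have 0: "0 \<in> quad_sym_ideal"
    by (simp add: quad_sym_ideal_def)
  have add: "p + q \<in> quad_sym_ideal" if "p \<in> quad_sym_ideal" "q \<in> quad_sym_ideal" for p q :: "'k tensor"
    using that by (simp add: quad_sym_ideal_def lookup_add)
  have short: "Poly_Mapping.lookup t v = 0" if "length v < 2" for v
    using t that by (simp add: quad_sym_ideal_def)
  have swap: "Poly_Mapping.lookup t [b, c] = Poly_Mapping.lookup t [c, b]" for b c
    using t by (auto simp: quad_sym_ideal_def)
  have "Poly_Mapping.single u c * t \<in> quad_sym_ideal" for u c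
  proof (cases "u = []")
    case False
    then have "Poly_Mapping.lookup (Poly_Mapping.single u c * t) v = 0" if "length v \<le> 2" for v
      using that by (cases u) (auto simp: lookup_mult_single_left intro!: short)
    then show ?thesis by (simp add: quad_sym_ideal_def)
  qed (use short swap in \<open>auto simp: quad_sym_ideal_def lookup_mult_single_left\<close>)
  then show "s * t \<in> quad_sym_ideal"
    by (induction s rule: single_induct) (simp_all add: 0 add distrib_right)
  have "t * Poly_Mapping.single u c \<in> quad_sym_ideal" for u c
  proof (cases "u = []")
    case False
    then have "Poly_Mapping.lookup (t * Poly_Mapping.single u c) v = 0" if "length v \<le> 2" for v
      using that by (cases u) (auto simp: lookup_mult_single_right intro!: short)
    then show ?thesis by (simp add: quad_sym_ideal_def)
  qed (use short swap in \<open>auto simp: quad_sym_ideal_def lookup_mult_single_right\<close>)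
  then show "t * s \<in> quad_sym_ideal"
    by (induction s rule: single_induct) (simp_all add: 0 add distrib_left)
qed (simp_all add: quad_sym_ideal_def lookup_add)

lemma sym_tens_2_quad_sym_ideal: "t \<in> sym_tens 2 \<Longrightarrow> t \<in> quad_sym_ideal"
  by (simp add: sym_tens_2_iff tens_iff quad_sym_ideal_def)

text \<open>An upper bound for the ideal of \<open>A_poisson B l\<close>; it meets V only in 0, so
  no nonzero linear form vanishes in that quotient.\<close>

definition quad_ideal :: "'k::field tensor set"
  where "quad_ideal = {t. \<forall>w. length w < 2 \<longrightarrow> Poly_Mapping.lookup t w = 0}"

lemma ideal_quad_ideal: "ideal (quad_ideal :: 'k::field tensor set) TV"
proof (rule ideal_ring_of_type_algebraI)
  fix s t :: "'k tensor" assume t: "t \<in> quad_ideal"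
  have add: "p + q \<in> quad_ideal" if "p \<in> quad_ideal" "q \<in> quad_ideal" for p q :: "'k tensor"
    using that by (simp add: quad_ideal_def lookup_add)
  have single: "Poly_Mapping.single u c * t \<in> quad_ideal" "t * Poly_Mapping.single u c \<in> quad_ideal" for u c
    using t by (auto simp: quad_ideal_def lookup_mult_single_left lookup_mult_single_right)
  have 0: "0 \<in> quad_ideal"
    by (simp add: quad_ideal_def)
  show "s * t \<in> quad_ideal" "t * s \<in> quad_ideal"
    by (induction s rule: single_induct) (simp_all add: single 0 add distrib_right distrib_left)
qed (simp_all add: quad_ideal_def lookup_add)

lemma tens_2_quad_ideal: "t \<in> tens 2 \<Longrightarrow> t \<in> quad_ideal"
  by (simp add: tens_iff quad_ideal_def)

lemma lookup_mult_tens_1: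
  assumes "u \<in> tens 1" "v \<in> tens 1"
  shows "Poly_Mapping.lookup (u * v) [b, c] = Poly_Mapping.lookup u [b] * Poly_Mapping.lookup v [c]"
  using assms(1)
proof (induction u rule: tens_1_induct)
  case (word a k)
  have "k *\<^sub>k word [a] * v = Poly_Mapping.single [a] k * v"
    by (simp add: single_eq_scale_word)
  then show ?case by (simp add: lookup_mult_single_left lookup_scale lookup_word eq_commute[of a])
qed (simp_all add: lookup_add distrib_right)

lemma tens_1_eqI:
  "s \<in> tens 1 \<Longrightarrow> t \<in> tens 1 \<Longrightarrow> (\<And>a. Poly_Mapping.lookup s [a] = Poly_Mapping.lookup t [a]) \<Longrightarrow> s = t"
  by (rule tens_eqI[of _ 1]) (auto simp: length_Suc_conv)

theorem not_graded_isomorphic_if_sym_tens: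
  fixes w :: "'k::field tensor"
  assumes two: "(2 :: 'k) \<noteq> 0" and sym: "\<And>a. cyc_deriv a w \<in> sym_tens 2"
    and B: "quadratic_poisson B"
  shows "\<not> graded_isomorphic (jacobi_algebra w) (A_poisson B l)"
proof
  define S where "S = {cyc_deriv Lx w, cyc_deriv Ly w, cyc_deriv Lz w}"
  define R where "R = relations B l"
  assume "graded_isomorphic (jacobi_algebra w) (A_poisson B l)"
  then obtain \<phi> where \<phi>: "\<phi> \<in> graded_algebra_iso (TV_quotient S) (TV_quotient R)"
    by (auto simp: graded_isomorphic_def jacobi_algebra_def A_poisson_def S_def R_def)
  have "of_nat (fact 2) \<noteq> (0 :: 'k)" using two by (simp add: fact_numeral)
  then have hat: "hat 2 (B (bar u) (bar v)) \<in> sym_tens 2" if "u \<in> tens 1" "v \<in> tens 1" for u v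
    using that B bar_tens hat_eq_polarization polarization_sym_tens_bar
    by (metis quadratic_poisson_def)
  have S: "TV_ideal S \<subseteq> quad_sym_ideal"
    using sym by (intro TV_ideal_minimal ideal_quad_sym_ideal) (auto simp: S_def sym_tens_2_quad_sym_ideal)
  have tens_2: "u * v \<in> tens 2" if "u \<in> tens 1" "v \<in> tens 1" for u v :: "'k tensor"
    using tens_mult[OF that] by (simp add: numeral_2_eq_2)
  have R: "TV_ideal R \<subseteq> quad_ideal"
    by (intro TV_ideal_minimal ideal_quad_ideal)
      (auto simp: R_def relations_def intro!: tens_2_quad_ideal tens_diff tens_scale tens_2
        hat[THEN sym_tens_tens])
  \<comment> \<open>The isomorphism is handled through representatives: \<open>rel\<close> is
    compatible with all operations, so \<open>\<phi>\<close> need not be lifted to a map on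
    TV.\<close>
  define rel where "rel T t \<longleftrightarrow> \<phi> (TV_class S T) = TV_class R t" for T t
  have iso: "\<phi> \<in> ring_iso (TV_quotient S) (TV_quotient R)"
    and smult: "\<And>a T. \<phi> (TV_class S (a *\<^sub>k T)) = a \<odot>\<^bsub>TV_quotient R\<^esub> \<phi> (TV_class S T)"
    and comp: "\<And>n. \<phi> ` component (TV_quotient S) n = component (TV_quotient R) n"
    using \<phi> unfolding graded_algebra_iso_def by (auto simp flip: TV_quotient_simps(4) intro: TV_quotient_simps(1))
  have rel_add: "rel (T + U) (t + u)" and rel_mult: "rel (T * U) (t * u)" if "rel T t" "rel U u" for T U t u
    using that ring_iso_memE(2,3)[OF iso TV_quotient_simps(1) TV_quotient_simps(1), of T U]
    by (simp_all add: rel_def TV_quotient_simps)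
  have rel_scale: "rel (a *\<^sub>k T) (a *\<^sub>k t)" if "rel T t" for a T t
    using that by (simp add: rel_def smult TV_quotient_simps)
  have rel_diff: "rel (T - U) (t - u)" if "rel T t" "rel U u" for T U t u
  proof -
    have "T + (- 1) *\<^sub>k U = T - U" "t + (- 1) *\<^sub>k u = t - u"
      by (rule poly_mapping_eqI; simp add: lookup_add lookup_minus lookup_scale)+
    then show ?thesis using rel_add[OF that(1) rel_scale[OF that(2), of "- 1"]] by simp
  qed
  have rel_exists: "\<exists>T\<in>tens n. rel T t" if "t \<in> tens n" for t n
  proof -
    have "TV_class R t \<in> \<phi> ` TV_class S ` tens n"
      using comp[of n] that by (simp add: TV_quotient_simps)
    then show ?thesis by (auto simp: rel_def)
  qed
  \<comment> \<open>Preservation of 0 follows by subtracting a related pair from itself.\<close>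
  obtain T where "rel T 0"
    using rel_exists[of 0 0] tens_zero by auto
  then have rel_zero: "rel 0 0"
    using rel_diff[of T 0 T 0] by simp
  have rel_right: "t \<in> TV_ideal R" if "rel 0 t" for t
    using that rel_zero coset_eq_iff[OF ideal_TV_ideal, of R t 0] by (simp add: rel_def)
  \<comment> \<open>Injectivity of \<open>\<phi>\<close> pulls relations of the target back to the
    source.\<close>
  have rel_left: "T \<in> TV_ideal S" if "rel T t" "t \<in> TV_ideal R" for T t
  proof -
    have "\<phi> (TV_class S T) = \<phi> (TV_class S 0)"
      using that rel_zero coset_eq_iff[OF ideal_TV_ideal, of R t 0] by (simp add: rel_def)
    then have "TV_class S T = TV_class S 0"
      using ring_iso_memE(5)[OF iso] TV_quotient_simps(1) by (metis bij_betw_imp_inj_on inj_onD)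
    then show ?thesis
      using coset_eq_iff[OF ideal_TV_ideal, of S T 0] by simp
  qed
  have rel_sum: "rel (\<Sum>i\<in>A. P i) (\<Sum>i\<in>A. p i)" if "\<And>i. rel (P i) (p i)" for A :: "letter set" and P p
    by (induction A rule: infinite_finite_induct) (simp_all add: rel_zero rel_add that)

  \<comment> \<open>The forms \<open>U a\<close> exist because \<open>\<phi>\<close> maps the degree
    1 component onto the degree 1 component.\<close>
  have "\<forall>a. \<exists>T. T \<in> tens 1 \<and> rel T (word [a])"
    using rel_exists tens_word[of "[_]" 1] by fastforce
  then obtain U where U: "\<And>a. U a \<in> tens 1" "\<And>a. rel (U a) (word [a])"
    by metis
  define h where "h = hat 2 (B (bar (word [Lx])) (bar (word [Ly])))"
  have h: "h \<in> sym_tens 2"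
    unfolding h_def by (rule hat) (simp_all add: tens_word)
  \<comment> \<open>\<open>H\<close> substitutes the forms \<open>U b\<close> for the letters
    \<open>b\<close> in \<open>h\<close>; expanding \<open>h\<close> in words shows that
    \<open>\<phi>\<close> takes its class to that of \<open>h\<close>.\<close>
  define H where "H = (\<Sum>b\<in>{Lx, Ly, Lz}. \<Sum>c\<in>{Lx, Ly, Lz}. Poly_Mapping.lookup h [b, c] *\<^sub>k (U b * U c))"
  have "h = (\<Sum>b\<in>{Lx, Ly, Lz}. \<Sum>c\<in>{Lx, Ly, Lz}. Poly_Mapping.lookup h [b, c] *\<^sub>k (word [b] * word [c]))"
    (is "_ = ?h")
  proof (rule tens_eqI[of _ 2])
    fix v :: "letter list" assume "length v = 2"
    then obtain b c where v: "v = [b, c]" by (rule length_2_cases)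
    show "Poly_Mapping.lookup h v = Poly_Mapping.lookup ?h v"
      by (cases b; cases c) (simp_all add: v lookup_add lookup_scale word_mult lookup_word)
  qed (use h in \<open>auto simp: word_mult tens_word sym_tens_tens intro!: tens_sum tens_scale tens_add\<close>)
  moreover have "rel H ?h"
    unfolding H_def by (intro rel_sum rel_scale rel_mult U)
  ultimately have "rel H h" by simp
  \<comment> \<open>The relation between x and y pulled back to the source; it lies in the ideal of
    J(w), so its quadratic part is symmetric.\<close>
  define D where "D = U Lx * U Ly - U Ly * U Lx - l *\<^sub>k H"
  have "rel D (word [Lx] * word [Ly] - word [Ly] * word [Lx] - l *\<^sub>k h)"
    unfolding D_def by (intro rel_diff rel_mult rel_scale U \<open>rel H h\<close>)
  moreover have "word [Lx] * word [Ly] - word [Ly] * word [Lx] - l *\<^sub>k h \<in> R"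
    unfolding R_def relations_def h_def using tens_word[of "[_]" 1] by fastforce
  ultimately have "D \<in> quad_sym_ideal"
    using rel_left TV_ideal_superset S by blast
  then have D: "Poly_Mapping.lookup D [b, c] = Poly_Mapping.lookup D [c, b]" for b c
    by (auto simp: quad_sym_ideal_def)
  note mult = lookup_mult_tens_1[OF U(1) U(1)]
  \<comment> \<open>Substitution preserves the symmetry of \<open>h\<close>: exchanging
    \<open>b\<close> and \<open>c\<close> exchanges the two summation letters.\<close>
  have H: "Poly_Mapping.lookup H [b, c] = Poly_Mapping.lookup H [c, b]" for b c
  proof -
    have "Poly_Mapping.lookup h [b, c] = Poly_Mapping.lookup h [c, b]" for b c
      using h by (simp add: sym_tens_2_iff)
    from this[of Ly Lx] this[of Lz Lx] this[of Lz Ly] show ?thesis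
      by (simp add: H_def lookup_add lookup_scale mult algebra_simps)
  qed
  define p q where "p a = Poly_Mapping.lookup (U Lx) [a]" and "q a = Poly_Mapping.lookup (U Ly) [a]" for a
  \<comment> \<open>In the difference of the coefficients of \<open>D\<close> at
    \<open>[b, c]\<close> and \<open>[c, b]\<close> the symmetric \<open>H\<close> cancels; twice a
    2x2 minor of the coordinates of \<open>U Lx\<close> and \<open>U Ly\<close> remains.\<close>
  have pq: "q c * p b = p c * q b" for b c
  proof -
    have "2 * (q c * p b - p c * q b) = 0"
      using D[of b c] unfolding D_def lookup_minus lookup_scale mult H[of c b] p_def q_def
      by (simp add: algebra_simps)
    then show ?thesis using two by simp
  qed
  \<comment> \<open>The vanishing minors give a linear relation between \<open>U Lx\<close> and
    \<open>U Ly\<close>, which \<open>\<phi>\<close> carries to the same relation between x and y.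
    It must be trivial, and its coefficient at y is \<open>- p c\<close>.\<close>
  have "p c = 0" for c
  proof -
    have "q c *\<^sub>k U Lx - p c *\<^sub>k U Ly = 0"
      using pq[of c] by (intro tens_1_eqI tens_diff tens_scale U tens_zero)
        (simp add: lookup_minus lookup_scale p_def q_def)
    then have "rel 0 (q c *\<^sub>k word [Lx] - p c *\<^sub>k word [Ly])"
      using rel_diff[OF rel_scale[OF U(2)] rel_scale[OF U(2)]] by metis
    then have "q c *\<^sub>k word [Lx] - p c *\<^sub>k word [Ly] \<in> quad_ideal"
      using rel_right R by blast
    then have "Poly_Mapping.lookup (q c *\<^sub>k word [Lx] - p c *\<^sub>k word [Ly]) [Ly] = 0"
      by (simp add: quad_ideal_def)
    then show ?thesis by (simp add: lookup_minus lookup_scale lookup_word)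
  qed
  then have "U Lx = 0"
    by (intro tens_1_eqI U tens_zero) (simp add: p_def)
  then have "(word [Lx] :: 'k tensor) \<in> quad_ideal"
    using rel_right[of "word [Lx]"] U(2)[of Lx] R by auto
  then have "Poly_Mapping.lookup (word [Lx] :: 'k tensor) [Lx] = 0"
    unfolding quad_ideal_def by simp
  then show False by (simp add: lookup_word)
qed

theorem theorem3p2:
  fixes f :: "'k::alg_closed_field spoly" and l :: 'k and w :: "'k tensor"
  assumes "CHAR('k) \<noteq> 2" and "CHAR('k) \<noteq> 3"
    and "f \<in> spow 3" and "w \<in> tens 3"
  shows "A_cubic f l = jacobi_algebra (w0 - l *\<^sub>k hat 3 f) \<and>
    (cyc_sym w \<noteq> full_sym w \<longrightarrow>
      jacobi_algebra w = A_cubic (bar w) (- inverse (mu w))) \<and>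
    (cyc_sym w = full_sym w \<longrightarrow>
      (\<forall>B l'. quadratic_poisson B \<longrightarrow>
        \<not> graded_isomorphic (jacobi_algebra w) (A_poisson B l')))"
proof (intro conjI impI allI)
  note char = nonzero_if_CHAR_neq[OF assms(1,2)]
  \<comment> \<open>\<open>cyc_deriv a t\<close> is symmetric with image
    \<open>partial a (bar t)\<close> in SV, which characterizes \<open>hat 2\<close> of that
    image.\<close>
  have deriv_hat: "cyc_deriv a t = hat 2 (partial a (bar t))" if "t \<in> sym_tens 3" for a and t :: "'k tensor"
    using that hat_bar[OF cyc_deriv_sym_tens[OF that] char(3), of a] bar_cyc_deriv[OF sym_tens_tens[OF that]]
    by simp
  have full: "full_sym w \<in> sym_tens 3" "bar (full_sym w) = bar w"
    using assms(4) char(4) by (simp_all add: full_sym_eq_symmetrizer symmetrizer_sym_tens bar_symmetrizer)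
  show "A_cubic f l = jacobi_algebra (w0 - l *\<^sub>k hat 3 f)"
  proof (rule jacobi_algebra_eq_A_cubic[symmetric, where c = 1])
    have "hat 3 f \<in> sym_tens 3" "bar (hat 3 f) = f"
      using polarization_sym_tens_bar[OF assms(3) char(4)] hat_eq_polarization[OF assms(3) char(4)] by simp_all
    then show "cyc_deriv a (w0 - l *\<^sub>k hat 3 f) = 1 *\<^sub>k (comm_relation a - l *\<^sub>k hat 2 (partial a f))" for a
      by (simp add: cyc_deriv_diff cyc_deriv_scale cyc_deriv_w0 char(2) deriv_hat scale_one)
  qed (use char assms in simp_all)
  have cyc: "cyc_deriv a w = mu w *\<^sub>k comm_relation a + hat 2 (partial a (bar w))" for a
  proof -
    have "cyc_deriv a w = cyc_deriv a (mu w *\<^sub>k w0 + full_sym w)"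
      using cyc_sym_minus_full_sym[OF assms(4) char(1,2)] cyc_deriv_cyc_sym[OF assms(4) char(2)]
      by (metis diff_add_cancel)
    then show ?thesis
      using full by (simp add: cyc_deriv_add cyc_deriv_scale cyc_deriv_w0 char(2) deriv_hat)
  qed
  show "jacobi_algebra w = A_cubic (bar w) (- inverse (mu w))" if "cyc_sym w \<noteq> full_sym w"
  proof (rule jacobi_algebra_eq_A_cubic[where c = "mu w"])
    show mu: "mu w \<noteq> 0"
      using cyc_sym_minus_full_sym[OF assms(4) char(1,2)] that by (auto simp: scale_zero_left)
    \<comment> \<open>Factoring out \<open>mu w\<close> leaves the symmetric part with coefficient
      \<open>inverse (mu w)\<close>, which is the parameter with reversed sign.\<close>
    show "cyc_deriv a w = mu w *\<^sub>k (comm_relation a - (- inverse (mu w)) *\<^sub>k hat 2 (partial a (bar w)))" for a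
      unfolding cyc by (rule poly_mapping_eqI) (use mu in \<open>simp add: lookup_scale lookup_add lookup_minus algebra_simps\<close>)
    show "bar w \<in> spow 3"
      using assms(4) by (rule bar_tens)
  qed (rule char)
  show "\<not> graded_isomorphic (jacobi_algebra w) (A_poisson B l')"
    if "cyc_sym w = full_sym w" "quadratic_poisson B" for B l'
  proof (rule not_graded_isomorphic_if_sym_tens[OF char(1) _ that(2)])
    \<comment> \<open>Here \<open>cyc_sym w\<close> is itself a symmetric tensor, and
      \<open>w\<close> has the same cyclic derivatives.\<close>
    show "cyc_deriv a w \<in> sym_tens 2" for a
      using that(1) cyc_deriv_sym_tens[OF full(1)] cyc_deriv_cyc_sym[OF assms(4) char(2)] by metis
  qed
qed

end
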